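(* The set $\{z_n\}_n$ is finite if and only if $[K(z):K]\leq2$. In particular, the coefficient sequence $(a_n,b_n)_n$ can be chosen to be eventually periodic and infinite if and only if $[K(z):K]=2$.
   Context: Let $\mathcal{O}=\mathbb{Z}[\tau]$ be the ring of discriminant $\Delta$ in an imaginary quadratic field $K$. An ideal is reduced if it is integral and has minimal norm among integral ideals in its class; $D(z,r)$ is the closed disc of radius $r$ centered at $z$. A nonempty finite $B\subset\mathcal{O}\setminus\{0\}$ is admissible with $\varepsilon\in(0,1)$ if for every reduced ideal $\mathfrak{b}$ with $\mathfrak{b}\cap B\neq\emptyset$, $\mathbb{C}=\bigcup D(a/b,\varepsilon/|b|)$ over $a\in\mathfrak{b}^{-1}$, $b\in\mathfrak{b}\cap B$ with $(a\mathfrak{b},b/\mathfrak{b})$ reduced. Fix such $B,\varepsilon$. Let $S(a,b)=\begin{bmatrix}a&1\\ b&0\end{bmatrix}$, $(M)_1$ the ideal generated by the first-column entries of $M$; matrices act as Möbius transformations. Given $z\in\mathbb{C}$, the continued fraction algorithm sets $M_0=I$, $b_0=1$, and for $n\ge1$ chooses (in any way; several choices may be available) $b_n\in B$ and $a_n\in\mathcal{O}\cap D(b_nM_{n-1}^{-1}(z),\varepsilon|b_{n-1}|)$ with $(M_{n-1}S(a_n/b_{n-1},b_n/b_{n-1}))_1$ reduced, and sets $M_n=M_{n-1}S(a_n/b_{n-1},b_n/b_{n-1})$, stopping if $z$ equals the first-column ratio of $M_n$. Let $z_n=M_n^{-1}(z)$. The first statement holds for every expansion of $z$ produced this way. *)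

theory Defs
  imports
    "HOL-Analysis.Analysis"
    "HOL-Library.Set_Algebras"
    "HOL-Algebra.Generated_Fields"
    "HOL-Algebra.Embedded_Algebras"
    "HOL-Algebra.Algebraic_Closure_Type"
begin

section \<open>Imaginary quadratic orders\<close>

text \<open>
  Every imaginary quadratic order is, up to the choice of a complex embedding, the ring
  \<open>\<int>[\<tau>]\<close> below for a unique negative discriminant \<open>\<Delta>\<close> congruent to 0 or 1 modulo 4.
\<close>

definition quad_tau :: "int \<Rightarrow> complex" where
  "quad_tau \<Delta> = (of_int \<Delta> + csqrt (of_int \<Delta>)) / 2"

definition quad_ring :: "int \<Rightarrow> complex set" where
  "quad_ring \<Delta> = {x + y * quad_tau \<Delta> | x y. x \<in> \<int> \<and> y \<in> \<int>}"

definition quad_field :: "int \<Rightarrow> complex set" where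
  "quad_field \<Delta> = {x + y * quad_tau \<Delta> | x y. x \<in> \<rat> \<and> y \<in> \<rat>}"

text \<open>
  \<open>has_degree \<Delta> z d\<close> says \<open>[K(z) : K] = d\<close>; it holds for no \<open>d\<close> if \<open>z\<close> is
  transcendental over \<open>K\<close>.
\<close>

definition adjoin :: "int \<Rightarrow> complex \<Rightarrow> complex set" where
  "adjoin \<Delta> z = generate_field ring_of_type_algebra (insert z (quad_field \<Delta>))"

definition has_degree :: "int \<Rightarrow> complex \<Rightarrow> nat \<Rightarrow> bool" where
  "has_degree \<Delta> z d \<longleftrightarrow>
     ring.dimension (ring_of_type_algebra :: complex ring) d (quad_field \<Delta>) (adjoin \<Delta> z)"


section \<open>Ideals\<close>

definition frac_ideal :: "int \<Rightarrow> complex set \<Rightarrow> bool" where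
  "frac_ideal \<Delta> I \<longleftrightarrow>
     I \<subseteq> quad_field \<Delta> \<and> 0 \<in> I \<and> I \<noteq> {0} \<and>
     (\<forall>x\<in>I. \<forall>y\<in>I. x + y \<in> I) \<and>
     (\<forall>c\<in>quad_ring \<Delta>. \<forall>x\<in>I. c * x \<in> I) \<and>
     (\<exists>d\<in>quad_ring \<Delta> - {0}. d *o I \<subseteq> quad_ring \<Delta>)"

definition ideal_mult :: "complex set \<Rightarrow> complex set \<Rightarrow> complex set" where
  "ideal_mult I J = {\<Sum>i<n. x i * y i | (n::nat) x y. \<forall>i<n. x i \<in> I \<and> y i \<in> J}"

definition ideal_inv :: "int \<Rightarrow> complex set \<Rightarrow> complex set" where
  "ideal_inv \<Delta> I = {x \<in> quad_field \<Delta>. \<forall>y\<in>I. x * y \<in> quad_ring \<Delta>}"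

text \<open>
  Ideal classes and inverses refer to invertible ideals. When \<open>\<Delta>\<close> is fundamental this
  is no restriction, as then every fractional ideal is invertible.
\<close>

definition invertible_ideal :: "int \<Rightarrow> complex set \<Rightarrow> bool" where
  "invertible_ideal \<Delta> I \<longleftrightarrow> frac_ideal \<Delta> I \<and> ideal_mult I (ideal_inv \<Delta> I) = quad_ring \<Delta>"

definition integral_ideal :: "int \<Rightarrow> complex set \<Rightarrow> bool" where
  "integral_ideal \<Delta> I \<longleftrightarrow> invertible_ideal \<Delta> I \<and> I \<subseteq> quad_ring \<Delta>"

definition same_class :: "int \<Rightarrow> complex set \<Rightarrow> complex set \<Rightarrow> bool" where
  "same_class \<Delta> I J \<longleftrightarrow> (\<exists>c\<in>quad_field \<Delta> - {0}. J = c *o I)"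

definition ideal_norm :: "int \<Rightarrow> complex set \<Rightarrow> nat" where
  "ideal_norm \<Delta> I = card ((\<lambda>x. x +o I) ` quad_ring \<Delta>)"

definition reduced_ideal :: "int \<Rightarrow> complex set \<Rightarrow> bool" where
  "reduced_ideal \<Delta> I \<longleftrightarrow>
     integral_ideal \<Delta> I \<and>
     (\<forall>J. integral_ideal \<Delta> J \<and> same_class \<Delta> I J \<longrightarrow> ideal_norm \<Delta> I \<le> ideal_norm \<Delta> J)"

definition ideal_gen2 :: "int \<Rightarrow> complex \<Rightarrow> complex \<Rightarrow> complex set" where
  "ideal_gen2 \<Delta> x y = {u * x + v * y | u v. u \<in> quad_ring \<Delta> \<and> v \<in> quad_ring \<Delta>}"

text \<open>The ideal \<open>(a\<bb>, b/\<bb>)\<close> generated by two ideals is the sum \<open>a\<bb> + b\<bb>\<^sup>-\<^sup>1\<close>.\<close>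

definition admissible :: "int \<Rightarrow> complex set \<Rightarrow> real \<Rightarrow> bool" where
  "admissible \<Delta> B \<epsilon> \<longleftrightarrow>
     finite B \<and> B \<noteq> {} \<and> B \<subseteq> quad_ring \<Delta> - {0} \<and> 0 < \<epsilon> \<and> \<epsilon> < 1 \<and>
     (\<forall>I. reduced_ideal \<Delta> I \<and> I \<inter> B \<noteq> {} \<longrightarrow>
        (\<Union>(a, b) \<in> {(a, b). a \<in> ideal_inv \<Delta> I \<and> b \<in> I \<inter> B \<and>
                        reduced_ideal \<Delta> (a *o I + b *o ideal_inv \<Delta> I)}.
           cball (a / b) (\<epsilon> / cmod b)) = UNIV)"


section \<open>The continued fraction algorithm\<close>

definition S_mat :: "complex \<Rightarrow> complex \<Rightarrow> complex^2^2" where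
  "S_mat a b = vector [vector [a, 1], vector [b, 0]]"

definition col1_ideal :: "int \<Rightarrow> complex^2^2 \<Rightarrow> complex set" where
  "col1_ideal \<Delta> M = ideal_gen2 \<Delta> (M $ 1 $ 1) (M $ 2 $ 1)"

text \<open>Moebius action on finite points, with \<open>None\<close> as the point at infinity.\<close>

definition moebius :: "complex^2^2 \<Rightarrow> complex \<Rightarrow> complex option" where
  "moebius M z =
     (if M $ 2 $ 1 * z + M $ 2 $ 2 = 0 then None
      else Some ((M $ 1 $ 1 * z + M $ 1 $ 2) / (M $ 2 $ 1 * z + M $ 2 $ 2)))"

primrec cf_mat :: "(nat \<Rightarrow> complex) \<Rightarrow> (nat \<Rightarrow> complex) \<Rightarrow> nat \<Rightarrow> complex^2^2" where
  "cf_mat a b 0 = mat 1"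
| "cf_mat a b (Suc n) = cf_mat a b n ** S_mat (a (Suc n) / b n) (b (Suc n) / b n)"

definition cf_z :: "complex \<Rightarrow> (nat \<Rightarrow> complex) \<Rightarrow> (nat \<Rightarrow> complex) \<Rightarrow> nat \<Rightarrow> complex option" where
  "cf_z z a b n = moebius (matrix_inv (cf_mat a b n)) z"

definition cf_stops :: "complex \<Rightarrow> (nat \<Rightarrow> complex) \<Rightarrow> (nat \<Rightarrow> complex) \<Rightarrow> nat \<Rightarrow> bool" where
  "cf_stops z a b n \<longleftrightarrow>
     cf_mat a b n $ 2 $ 1 \<noteq> 0 \<and> z = cf_mat a b n $ 1 $ 1 / cf_mat a b n $ 2 $ 1"

definition cf_reaches :: "complex \<Rightarrow> (nat \<Rightarrow> complex) \<Rightarrow> (nat \<Rightarrow> complex) \<Rightarrow> nat \<Rightarrow> bool" where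
  "cf_reaches z a b n \<longleftrightarrow> (\<forall>m<n. \<not> cf_stops z a b m)"

text \<open>
  A complete run of the algorithm: it either stops or goes on forever. The value \<open>a 0\<close>
  and the values of \<open>a\<close> and \<open>b\<close> past the stopping index are irrelevant.
\<close>

definition cf_expansion ::
    "int \<Rightarrow> complex set \<Rightarrow> real \<Rightarrow> complex \<Rightarrow> (nat \<Rightarrow> complex) \<Rightarrow> (nat \<Rightarrow> complex) \<Rightarrow> bool" where
  "cf_expansion \<Delta> B \<epsilon> z a b \<longleftrightarrow>
     b 0 = 1 \<and>
     (\<forall>n. cf_reaches z a b (Suc n) \<longrightarrow>
        b (Suc n) \<in> B \<and>
        a (Suc n) \<in> quad_ring \<Delta> \<and>
        (\<exists>w. cf_z z a b n = Some w \<and>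
             a (Suc n) \<in> cball (b (Suc n) * w) (\<epsilon> * cmod (b n))) \<and>
        reduced_ideal \<Delta> (col1_ideal \<Delta> (cf_mat a b (Suc n))))"

definition cf_infinite :: "complex \<Rightarrow> (nat \<Rightarrow> complex) \<Rightarrow> (nat \<Rightarrow> complex) \<Rightarrow> bool" where
  "cf_infinite z a b \<longleftrightarrow> (\<forall>n. \<not> cf_stops z a b n)"

definition eventually_periodic :: "(nat \<Rightarrow> 'a) \<Rightarrow> bool" where
  "eventually_periodic s \<longleftrightarrow> (\<exists>N k. 0 < k \<and> (\<forall>n\<ge>N. s (n + k) = s n))"

end

theory Submission
  imports Defs
begin

text \<open>
  Write \<open>(p\<^sub>n, q\<^sub>n)\<close> for the first column of \<open>M\<^sub>n\<close>; its second column is the previous first column. The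
  errors \<open>e\<^sub>n = q\<^sub>n z - p\<^sub>n\<close> satisfy \<open>|e\<^sub>n\<^sub>+\<^sub>1| \<le> \<epsilon> |e\<^sub>n|\<close> and \<open>z\<^sub>n = - e\<^sub>n\<^sub>-\<^sub>1 / e\<^sub>n\<close>, while
  \<open>det M\<^sub>n = \<plusminus> b\<^sub>n\<close> is bounded.

  If \<open>z\<^sub>n = z\<^sub>m\<close>, then \<open>M\<^sub>m M\<^sub>n\<^sup>-\<^sup>1\<close> fixes \<open>z\<close>, and for large \<open>m\<close> it is not scalar because \<open>e\<^sub>m / e\<^sub>n\<close> is
  small; so \<open>z\<close> is at most quadratic. Conversely, if \<open>z\<close> is a root of an integral quadratic form, the
  forms transported by \<open>M\<^sub>n\<close> have roots \<open>z\<^sub>n\<close> and coefficients bounded in terms of \<open>q\<^sub>n e\<^sub>n\<close>, which is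
  bounded; as the order is discrete only finitely many forms, hence \<open>z\<^sub>n\<close>, occur.

  Coefficients determine the \<open>z\<^sub>n\<close> by contraction, so periodic coefficients give finitely many \<open>z\<^sub>n\<close>.
  For the converse, a step is always possible: a Bezout relation in \<open>\<bb> \<bb>\<^sup>-\<^sup>1\<close> turns the admissibility
  covering for \<open>\<bb> = (p\<^sub>n, q\<^sub>n)\<close> into a choice of \<open>a\<^sub>n\<^sub>+\<^sub>1, b\<^sub>n\<^sub>+\<^sub>1\<close>. By pigeonhole there are \<open>n < m\<close> with
  \<open>z\<^sub>n = z\<^sub>m\<close>, \<open>b\<^sub>n = b\<^sub>m\<close> and \<open>M\<^sub>m M\<^sub>n\<^sup>-\<^sup>1\<close> unimodular over the order; left multiplication by such a matrix
  preserves column ideals, so the choices made between \<open>n\<close> and \<open>m\<close> may be repeated forever.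
\<close>

section \<open>Arithmetic of the order and its field\<close>

locale imag_quad_order =
  fixes \<Delta> :: int
  assumes neg: "\<Delta> < 0" and mod4: "\<Delta> mod 4 \<in> {0, 1}"
begin

abbreviation "R \<equiv> quad_ring \<Delta>"
abbreviation "K \<equiv> quad_field \<Delta>"
abbreviation "tau \<equiv> quad_tau \<Delta>"

lemma quad_tau_eq: "tau = Complex (of_int \<Delta> / 2) (sqrt (- of_int \<Delta>) / 2)"
proof -
  have "csqrt (of_int \<Delta>) = \<i> * sqrt \<bar>Re (of_int \<Delta>)\<bar>"
    using neg by (intro csqrt_of_real_nonpos) auto
  then show ?thesis
    using neg by (simp add: quad_tau_def complex_eq_iff)
qed

lemma Im_tau_pos: "Im tau > 0"
  using neg by (simp add: quad_tau_eq)

text \<open>\<open>tau\<close> has trace \<open>\<Delta>\<close> and norm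
  \<open>m = \<Delta> * (\<Delta> - 1) / 4\<close>, integral by the congruence on
  \<open>\<Delta>\<close>; this closes the order under products.\<close>

lemma tau_square:
  obtains m :: int where "tau * tau = of_int \<Delta> * tau - of_int m"
proof -
  have "\<Delta> mod 4 = 0 \<or> \<Delta> mod 4 = 1" using mod4 by auto
  then have "4 dvd \<Delta> * (\<Delta> - 1)"
  proof
    assume "\<Delta> mod 4 = 1"
    then have "4 dvd \<Delta> - 1" by (simp add: mod_eq_dvd_iff[symmetric])
    then show ?thesis by simp
  qed (auto simp: mod_eq_0_iff_dvd)
  then obtain m where m: "\<Delta> * (\<Delta> - 1) = 4 * m" by (elim dvdE)
  have "of_int \<Delta> * (of_int \<Delta> - 1) = (4 * of_int m :: complex)"
    using arg_cong[OF m, of "of_int :: int \<Rightarrow> complex"] by simp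
  moreover have "(2 * tau - of_int \<Delta>)\<^sup>2 = of_int \<Delta>"
    by (simp add: quad_tau_def)
  ultimately have "4 * (tau * tau) = 4 * (of_int \<Delta> * tau - of_int m)"
    by (simp add: power2_eq_square algebra_simps)
  then have "tau * tau = of_int \<Delta> * tau - of_int m"
    by (metis mult_cancel_left zero_neq_numeral)
  then show ?thesis by (rule that)
qed

lemma cnj_tau: "cnj tau = of_int \<Delta> - tau"
  by (simp add: quad_tau_eq complex_eq_iff)

lemma ringE:
  assumes "u \<in> R"
  obtains x y :: int where "u = of_int x + of_int y * tau"
  using assms unfolding quad_ring_def by (auto elim!: Ints_cases)

lemma ringI: "of_int x + of_int y * tau \<in> R"
  unfolding quad_ring_def using Ints_of_int by blast

lemma of_int_in_ring [simp]: "of_int x \<in> R"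
  using ringI[of x 0] by simp

lemma zero_one_in_ring [simp]: "0 \<in> R" "1 \<in> R"
  using of_int_in_ring[of 0] of_int_in_ring[of 1] by simp_all

lemma ring_add [intro]: "u \<in> R \<Longrightarrow> v \<in> R \<Longrightarrow> u + v \<in> R"
proof -
  assume "u \<in> R" "v \<in> R"
  then obtain x y x' y' where "u = of_int x + of_int y * tau" "v = of_int x' + of_int y' * tau"
    by (metis ringE)
  then have "u + v = of_int (x + x') + of_int (y + y') * tau"
    by (simp add: algebra_simps)
  then show ?thesis by (metis ringI)
qed

lemma ring_mult [intro]: "u \<in> R \<Longrightarrow> v \<in> R \<Longrightarrow> u * v \<in> R"
proof -
  assume "u \<in> R" "v \<in> R"
  then obtain x y x' y' where uv: "u = of_int x + of_int y * tau" "v = of_int x' + of_int y' * tau"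
    by (metis ringE)
  obtain m where m: "tau * tau = of_int \<Delta> * tau - of_int m" by (rule tau_square)
  have "u * v = of_int x * of_int x' + (of_int x * of_int y' + of_int y * of_int x') * tau
      + of_int y * of_int y' * (tau * tau)"
    unfolding uv by (simp add: algebra_simps)
  also have "\<dots> = of_int (x * x' - y * y' * m) + of_int (x * y' + y * x' + y * y' * \<Delta>) * tau"
    unfolding m by (simp add: algebra_simps)
  finally show ?thesis by (metis ringI)
qed

lemma ring_uminus [intro]: "u \<in> R \<Longrightarrow> - u \<in> R"
  using ring_mult[of "-1" u] of_int_in_ring[of "-1"] by simp

lemma ring_diff [intro]: "u \<in> R \<Longrightarrow> v \<in> R \<Longrightarrow> u - v \<in> R"
  using ring_add[of u "- v"] by auto

section \<open>Conjugation, norms and discreteness\<close>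

lemma ring_cnj: "u \<in> R \<Longrightarrow> cnj u \<in> R"
proof -
  assume "u \<in> R"
  then obtain x y where u: "u = of_int x + of_int y * tau" by (metis ringE)
  have "cnj u = of_int (x + y * \<Delta>) + of_int (- y) * tau"
    unfolding u by (simp add: cnj_tau algebra_simps)
  then show ?thesis by (metis ringI)
qed

lemma real_ring_elem: "of_real r \<in> R \<Longrightarrow> \<exists>k::int. r = of_int k"
proof -
  assume "of_real r \<in> R"
  then obtain x y where u: "of_real r = of_int x + of_int y * tau" by (metis ringE)
  have "Im (of_real r :: complex) = of_int y * Im tau" by (subst u) simp
  then have "y = 0" using Im_tau_pos by simp
  then have "(of_real r :: complex) = of_real (of_int x)" using u by simp
  then show ?thesis unfolding of_real_eq_iff by blast
qed

text \<open>\<open>u * cnj u\<close> is a real element of the order, and these are integers because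
  \<open>tau\<close> is not real.\<close>

lemma cmod_square_int:
  assumes "u \<in> R"
  obtains k :: int where "u * cnj u = of_int k" "(cmod u)\<^sup>2 = of_int k"
proof -
  have "of_real ((cmod u)\<^sup>2) = u * cnj u" by (metis complex_norm_square)
  then have "of_real ((cmod u)\<^sup>2) \<in> R" using assms ring_cnj ring_mult by simp
  then obtain k :: int where "(cmod u)\<^sup>2 = of_int k" using real_ring_elem by blast
  moreover from this have "u * cnj u = of_int k"
    by (metis complex_norm_square of_real_of_int_eq)
  ultimately show ?thesis using that by blast
qed

lemma cmod_ge_1:
  assumes "u \<in> R" "u \<noteq> 0"
  shows "cmod u \<ge> 1"
proof -
  obtain k :: int where k: "(cmod u)\<^sup>2 = of_int k" using cmod_square_int assms(1) by blast
  have "0 < (cmod u)\<^sup>2" using assms(2) by simp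
  then have "k \<ge> 1" using k by simp
  then have "1\<^sup>2 \<le> (cmod u)\<^sup>2" using k by simp
  then show ?thesis using power2_le_imp_le norm_ge_zero by blast
qed

text \<open>Bounding \<open>Im u\<close> bounds the coefficient of \<open>tau\<close>, and then the
  other coefficient is bounded too.\<close>

lemma finite_ring_bounded: "finite {u \<in> R. cmod u \<le> r}"
proof -
  define C where "C = \<bar>r\<bar> / Im tau"
  define D where "D = \<bar>r\<bar> + C * cmod tau"
  have bounded: "finite {x::int. \<bar>of_int x\<bar> \<le> (c::real)}" for c
  proof (rule finite_subset)
    show "{x::int. \<bar>of_int x\<bar> \<le> c} \<subseteq> {- \<lceil>c\<rceil> .. \<lceil>c\<rceil>}"
      by (auto simp: le_ceiling_iff minus_le_iff)
  qed simp
  have "{u \<in> R. cmod u \<le> r} \<subseteq> (\<lambda>(x, y). of_int x + of_int y * tau) `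
      ({x::int. \<bar>of_int x\<bar> \<le> D} \<times> {y::int. \<bar>of_int y\<bar> \<le> C})"
  proof (clarsimp)
    fix u assume u: "u \<in> R" "cmod u \<le> r"
    then obtain x y where uv: "u = of_int x + of_int y * tau" by (metis ringE)
    have "\<bar>Im u\<bar> \<le> \<bar>r\<bar>" using abs_Im_le_cmod[of u] u by linarith
    then have "\<bar>of_int y\<bar> * Im tau \<le> \<bar>r\<bar>"
      using Im_tau_pos by (simp add: uv abs_mult)
    then have y: "\<bar>of_int y\<bar> \<le> C"
      using Im_tau_pos by (simp add: C_def pos_le_divide_eq)
    have "\<bar>of_int x\<bar> = cmod (u - of_int y * tau)" by (simp add: uv)
    also have "\<dots> \<le> cmod u + cmod (of_int y * tau)" by (rule norm_triangle_ineq4)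
    also have "cmod (of_int y * tau) \<le> C * cmod tau"
      using y by (simp add: norm_mult mult_right_mono)
    finally have "\<bar>of_int x\<bar> \<le> D" using u by (simp add: D_def)
    with y uv show "u \<in> (\<lambda>(x, y). of_int x + of_int y * tau) `
      ({x::int. \<bar>of_int x\<bar> \<le> D} \<times> {y::int. \<bar>of_int y\<bar> \<le> C})" by auto
  qed
  then show ?thesis
    by (rule finite_subset) (intro finite_imageI finite_cartesian_product bounded)
qed

section \<open>The field as fractions over the order\<close>

lemma fieldE:
  assumes "u \<in> K"
  obtains d where "d \<in> R" "d \<noteq> 0" "d * u \<in> R"
proof -
  obtain x y where xy: "x \<in> \<rat>" "y \<in> \<rat>" "u = x + y * tau"
    using assms unfolding quad_field_def by auto
  obtain p q :: int where x: "x = of_int p / of_int q" "q > 0"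
    using xy(1) by (metis Rats_cases' )
  obtain p' q' :: int where y: "y = of_int p' / of_int q'" "q' > 0"
    using xy(2) by (metis Rats_cases' )
  have "of_int (q * q') * u = of_int (p * q') + of_int (p' * q) * tau"
    unfolding xy(3) x(1) y(1) using x(2) y(2) by (simp add: field_simps)
  then have "of_int (q * q') * u \<in> R" by (metis ringI)
  then show ?thesis using x(2) y(2) by (intro that[of "of_int (q * q')"] of_int_in_ring) auto
qed

text \<open>Multiplying by \<open>cnj d\<close> turns the denominator \<open>d\<close> into the
  nonzero integer \<open>d * cnj d\<close>.\<close>

lemma fieldI:
  assumes "d \<in> R" "d \<noteq> 0" "d * u \<in> R"
  shows "u \<in> K"
proof -
  obtain k where k: "d * cnj d = of_int k" using cmod_square_int assms(1) by blast
  have k0: "k \<noteq> 0" using k assms(2) by (metis complex_cnj_zero_iff mult_eq_0_iff of_int_0)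
  have "cnj d * (d * u) \<in> R" using assms ring_cnj ring_mult by blast
  then obtain x y where xy: "cnj d * (d * u) = of_int x + of_int y * tau" by (metis ringE)
  have "of_int k * u = of_int x + of_int y * tau"
    using xy by (simp add: k[symmetric] mult_ac)
  then have "u = of_int x / of_int k + of_int y / of_int k * tau"
    using k0 by (simp add: field_simps)
  then show ?thesis unfolding quad_field_def by (blast intro: Rats_divide Rats_of_int)
qed

lemma ring_subset_field: "u \<in> R \<Longrightarrow> u \<in> K"
  by (rule fieldI[of 1]) auto

lemma field_add [intro]: "u \<in> K \<Longrightarrow> v \<in> K \<Longrightarrow> u + v \<in> K"
proof -
  assume "u \<in> K" "v \<in> K"
  then obtain d d' where d: "d \<in> R" "d \<noteq> 0" "d * u \<in> R" "d' \<in> R" "d' \<noteq> 0" "d' * v \<in> R"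
    by (metis fieldE)
  have "d * d' * (u + v) = d' * (d * u) + d * (d' * v)" by (simp add: algebra_simps)
  also have "\<dots> \<in> R" using d by blast
  finally show ?thesis using d by (intro fieldI[of "d * d'"]) auto
qed

lemma field_mult [intro]: "u \<in> K \<Longrightarrow> v \<in> K \<Longrightarrow> u * v \<in> K"
proof -
  assume "u \<in> K" "v \<in> K"
  then obtain d d' where d: "d \<in> R" "d \<noteq> 0" "d * u \<in> R" "d' \<in> R" "d' \<noteq> 0" "d' * v \<in> R"
    by (metis fieldE)
  have "d * d' * (u * v) = (d * u) * (d' * v)" by (simp add: algebra_simps)
  also have "\<dots> \<in> R" using d by blast
  finally show ?thesis using d by (intro fieldI[of "d * d'"]) auto
qed

lemma zero_one_in_field [simp]: "0 \<in> K" "1 \<in> K"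
  by (simp_all add: ring_subset_field)

lemma field_uminus [intro]: "u \<in> K \<Longrightarrow> - u \<in> K"
  using field_mult[of "-1" u] ring_subset_field[of "-1"] ring_uminus[of 1] by simp

lemma field_diff [intro]: "u \<in> K \<Longrightarrow> v \<in> K \<Longrightarrow> u - v \<in> K"
  using field_add[of u "- v"] by auto

lemma field_inverse [intro]: "u \<in> K \<Longrightarrow> inverse u \<in> K"
proof (cases "u = 0")
  case False
  assume "u \<in> K"
  then obtain d where d: "d \<in> R" "d \<noteq> 0" "d * u \<in> R" by (rule fieldE)
  show ?thesis by (rule fieldI[of "d * u"]) (use d False in \<open>auto simp: mult.assoc\<close>)
qed simp

lemma field_divide [intro]: "u \<in> K \<Longrightarrow> v \<in> K \<Longrightarrow> u / v \<in> K"
  unfolding divide_inverse by blast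

lemma ideal_gen2_mem: "x \<in> ideal_gen2 \<Delta> x y" "y \<in> ideal_gen2 \<Delta> x y"
proof -
  have "x = 1 * x + 0 * y" "y = 0 * x + 1 * y" by simp_all
  then show "x \<in> ideal_gen2 \<Delta> x y" "y \<in> ideal_gen2 \<Delta> x y"
    unfolding ideal_gen2_def using zero_one_in_ring by blast+
qed

end

section \<open>Degree of a point over the field\<close>

context imag_quad_order
begin

interpretation CR: field "ring_of_type_algebra :: complex ring"
  by (rule field_from_type_algebra)

lemma type_ring_simps:
  "carrier (ring_of_type_algebra :: complex ring) = UNIV"
  "mult (ring_of_type_algebra :: complex ring) x y = x * y"
  "add (ring_of_type_algebra :: complex ring) x y = x + y"
  "zero (ring_of_type_algebra :: complex ring) = 0"
  "one (ring_of_type_algebra :: complex ring) = 1"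
  by (simp_all add: ring_of_type_algebra_def)

lemma type_ring_a_inv: "a_inv (ring_of_type_algebra :: complex ring) x = - x"
  by (rule CR.minus_equality) (simp_all add: type_ring_simps)

lemma type_ring_m_inv:
  "x \<noteq> 0 \<Longrightarrow> m_inv (ring_of_type_algebra :: complex ring) x = inverse x"
  by (rule CR.comm_inv_char) (simp_all add: type_ring_simps)

lemma subfield_typeI:
  assumes "1 \<in> S" "\<And>x. x \<in> S \<Longrightarrow> - x \<in> S" "\<And>x y. x \<in> S \<Longrightarrow> y \<in> S \<Longrightarrow> x + y \<in> S"
    and "\<And>x y. x \<in> S \<Longrightarrow> y \<in> S \<Longrightarrow> x * y \<in> S" "\<And>x. x \<in> S \<Longrightarrow> x \<noteq> 0 \<Longrightarrow> inverse x \<in> S"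
  shows "subfield S (ring_of_type_algebra :: complex ring)"
proof (rule CR.subfieldI')
  show "subring S (ring_of_type_algebra :: complex ring)"
    by (rule CR.subringI) (use assms in \<open>auto simp: type_ring_simps type_ring_a_inv\<close>)
qed (use assms in \<open>auto simp: type_ring_simps type_ring_m_inv\<close>)

lemma subfield_K: "subfield K (ring_of_type_algebra :: complex ring)"
  by (rule subfield_typeI) auto

lemma adjoin_closed:
  "1 \<in> adjoin \<Delta> z" "z \<in> adjoin \<Delta> z" "k \<in> K \<Longrightarrow> k \<in> adjoin \<Delta> z"
  "x \<in> adjoin \<Delta> z \<Longrightarrow> y \<in> adjoin \<Delta> z \<Longrightarrow> x + y \<in> adjoin \<Delta> z"
  "x \<in> adjoin \<Delta> z \<Longrightarrow> y \<in> adjoin \<Delta> z \<Longrightarrow> x * y \<in> adjoin \<Delta> z"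
  using generate_field.one[of "ring_of_type_algebra :: complex ring" "insert z K"]
    generate_field.incl[of _ "insert z K" "ring_of_type_algebra :: complex ring"]
    generate_field.eng_add[of x "ring_of_type_algebra :: complex ring" "insert z K" y]
    generate_field.eng_mult[of x "ring_of_type_algebra :: complex ring" "insert z K" y]
  by (simp_all add: adjoin_def type_ring_simps)

lemma adjoin_minimal:
  assumes "subfield S (ring_of_type_algebra :: complex ring)" "K \<subseteq> S" "z \<in> S"
  shows "adjoin \<Delta> z \<subseteq> S"
  unfolding adjoin_def
  by (rule CR.generate_field_min_subfield1) (use assms in \<open>auto simp: type_ring_simps\<close>)

lemma line_extension_iff:
  "u \<in> CR.line_extension K v E \<longleftrightarrow> (\<exists>k\<in>K. \<exists>w\<in>E. u = k * v + w)"
  by (simp add: CR.line_extension_mem_iff type_ring_simps)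

section \<open>Degrees zero, one and two\<close>

lemma not_has_degree_0: "\<not> has_degree \<Delta> z 0"
proof
  assume "has_degree \<Delta> z 0"
  then have "adjoin \<Delta> z = {0}"
    unfolding has_degree_def by (metis CR.dimension_zero[OF subfield_K] type_ring_simps(4))
  then show False using adjoin_closed(1)[of z] by (metis singletonD zero_neq_one)
qed

lemma has_degree_unique: "has_degree \<Delta> z m \<Longrightarrow> has_degree \<Delta> z n \<Longrightarrow> m = n"
  unfolding has_degree_def by (rule CR.dimension_is_inj[OF subfield_K])

lemma has_degree_1_iff: "has_degree \<Delta> z 1 \<longleftrightarrow> z \<in> K"
proof
  assume "has_degree \<Delta> z 1"
  then obtain v E where "CR.dimension 0 K E" and E: "adjoin \<Delta> z = CR.line_extension K v E"
    using CR.dimension_backwards[OF subfield_K, of 0 "adjoin \<Delta> z"] unfolding has_degree_def by force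
  then have "E = {0}" using CR.dimension_zero[OF subfield_K] by (simp add: type_ring_simps)
  then have mem: "\<exists>k\<in>K. u = k * v" if "u \<in> adjoin \<Delta> z" for u
    using that unfolding E line_extension_iff by auto
  obtain k l where "k \<in> K" "1 = k * v" "l \<in> K" "z = l * v"
    using mem adjoin_closed(1,2) by meson
  moreover from this have "k \<noteq> 0" "k * z = l" by (auto simp: mult.left_commute)
  moreover from this have "z = l / k" by (simp add: field_simps)
  ultimately show "z \<in> K" using field_divide by metis
next
  assume "z \<in> K"
  then have "adjoin \<Delta> z = K" using adjoin_minimal[OF subfield_K] adjoin_closed(3) by blast
  then show "has_degree \<Delta> z 1"
    using CR.dimension_one[OF subfield_K] by (simp add: has_degree_def)
qed

text \<open>With \<open>1\<close>, \<open>z\<close> and \<open>z * z\<close> written in terms of two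
  spanning elements \<open>v\<close> and \<open>w\<close>, Cramer's rule recovers \<open>v\<close>
  and \<open>w\<close> from \<open>1\<close> and \<open>z\<close>, and so expresses
  \<open>z * z\<close>.\<close>

lemma has_degree_2D:
  assumes "has_degree \<Delta> z 2"
  shows "z \<notin> K" "\<exists>\<beta>\<in>K. \<exists>\<gamma>\<in>K. z * z = \<beta> * z + \<gamma>"
proof -
  show notin: "z \<notin> K"
    using has_degree_unique[OF assms, of 1] has_degree_1_iff by force
  have "CR.dimension (Suc (Suc 0)) K (adjoin \<Delta> z)"
    using assms by (simp add: has_degree_def numeral_2_eq_2)
  then obtain v w E F where "CR.dimension 0 K F"
    and E: "adjoin \<Delta> z = CR.line_extension K v E" "E = CR.line_extension K w F"
    using CR.dimension_backwards[OF subfield_K] by metis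
  then have "F = {0}" using CR.dimension_zero[OF subfield_K] by (simp add: type_ring_simps)
  then have mem: "\<exists>k\<in>K. \<exists>l\<in>K. u = k * v + l * w" if "u \<in> adjoin \<Delta> z" for u
    using that unfolding E(1) line_extension_iff E(2) by (auto simp: line_extension_iff) blast
  obtain k1 l1 where 1: "k1 \<in> K" "l1 \<in> K" "1 = k1 * v + l1 * w"
    using mem adjoin_closed(1) by meson
  obtain k2 l2 where 2: "k2 \<in> K" "l2 \<in> K" "z = k2 * v + l2 * w"
    using mem adjoin_closed(2) by meson
  obtain k3 l3 where 3: "k3 \<in> K" "l3 \<in> K" "z * z = k3 * v + l3 * w"
    using mem adjoin_closed(5)[OF adjoin_closed(2) adjoin_closed(2)] by meson
  define D where "D = k1 * l2 - k2 * l1"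
  have w: "k1 * z - k2 = D * w"
  proof -
    have "k1 * z - k2 * 1 = k1 * (k2 * v + l2 * w) - k2 * (k1 * v + l1 * w)"
      using 1(3) 2(3) by metis
    then show ?thesis by (simp add: D_def algebra_simps)
  qed
  have v: "l2 - l1 * z = D * v"
  proof -
    have "l2 * 1 - l1 * z = l2 * (k1 * v + l1 * w) - l1 * (k2 * v + l2 * w)"
      using 1(3) 2(3) by metis
    then show ?thesis by (simp add: D_def algebra_simps)
  qed
  have "D \<noteq> 0"
  proof
    assume "D = 0"
    then have "k1 * z = k2" "l1 * z = l2" using v w by auto
    moreover have "k1 \<noteq> 0 \<or> l1 \<noteq> 0" using 1(3) by auto
    ultimately have "z = k2 / k1 \<or> z = l2 / l1" by (auto simp: field_simps)
    then show False using notin 1 2 by auto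
  qed
  then have vw: "v = (l2 - l1 * z) / D" "w = (k1 * z - k2) / D"
    using v w by simp_all
  have "z * z = (l3 * k1 - k3 * l1) / D * z + (k3 * l2 - l3 * k2) / D"
  proof -
    have "z * z = k3 * ((l2 - l1 * z) / D) + l3 * ((k1 * z - k2) / D)"
      using 3(3) vw by metis
    then show ?thesis by (simp add: diff_divide_distrib algebra_simps)
  qed
  moreover have "D \<in> K" using 1 2 by (auto simp: D_def)
  ultimately show "\<exists>\<beta>\<in>K. \<exists>\<gamma>\<in>K. z * z = \<beta> * z + \<gamma>"
    using 1(1,2) 2(1,2) 3(1,2)
    by (intro bexI[of _ "(l3 * k1 - k3 * l1) / D"] bexI[of _ "(k3 * l2 - l3 * k2) / D"]) auto
qed

text \<open>The span of \<open>1\<close> and \<open>z\<close> is closed under products by the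
  relation and under inverses by conjugation, so it is the field generated by
  \<open>z\<close>.\<close>

lemma has_degree_2I:
  assumes "z \<notin> K" "\<beta> \<in> K" "\<gamma> \<in> K" "z * z = \<beta> * z + \<gamma>"
  shows "has_degree \<Delta> z 2"
proof -
  define E where "E = CR.line_extension K z K"
  have E_iff: "u \<in> E \<longleftrightarrow> (\<exists>y\<in>K. \<exists>x\<in>K. u = y * z + x)" for u
    by (simp add: E_def line_extension_iff)
  have "subfield E (ring_of_type_algebra :: complex ring)"
  proof (rule subfield_typeI)
    show "1 \<in> E" unfolding E_iff by (intro bexI[of _ 0] bexI[of _ 1]) auto
  next
    fix u assume "u \<in> E"
    then obtain y x where "y \<in> K" "x \<in> K" "u = y * z + x" by (auto simp: E_iff)
    then show "- u \<in> E" unfolding E_iff by (intro bexI[of _ "- y"] bexI[of _ "- x"]) auto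
  next
    fix u v assume "u \<in> E" "v \<in> E"
    then obtain y x y' x' where uv: "y \<in> K" "x \<in> K" "u = y * z + x"
      "y' \<in> K" "x' \<in> K" "v = y' * z + x'"
      by (auto simp: E_iff)
    then show "u + v \<in> E" unfolding E_iff
      by (intro bexI[of _ "y + y'"] bexI[of _ "x + x'"]) (auto simp: algebra_simps)
    have "u * v = y * y' * (z * z) + (x * y' + x' * y) * z + x * x'"
      using uv by (simp add: algebra_simps)
    also have "\<dots> = (y * y' * \<beta> + (x * y' + x' * y)) * z + (y * y' * \<gamma> + x * x')"
      unfolding assms(4) by (simp add: algebra_simps)
    finally show "u * v \<in> E" unfolding E_iff using uv(1,2,4,5) assms(2,3)
      by (intro bexI[of _ "y * y' * \<beta> + (x * y' + x' * y)"] bexI[of _ "y * y' * \<gamma> + x * x'"]) auto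
  next
    fix u assume "u \<in> E" "u \<noteq> 0"
    then obtain y x where u: "y \<in> K" "x \<in> K" "u = y * z + x" by (auto simp: E_iff)
    \<comment> \<open>\<open>N\<close> is the relative norm of \<open>u\<close>: the other root of
      the relation is \<open>\<beta> - z\<close>, so \<open>u\<close> has conjugate
      \<open>x + y * \<beta> - y * z\<close>.\<close>
    define N where "N = x * x + x * y * \<beta> - y * y * \<gamma>"
    have "u * (x + y * \<beta> - y * z) = x * x + x * y * \<beta> + y * y * (\<beta> * z) - y * y * (z * z)"
      unfolding u by (simp add: algebra_simps)
    then have N: "u * (x + y * \<beta> - y * z) = N"
      unfolding assms(4) N_def by (simp add: algebra_simps)
    have "x + y * \<beta> - y * z \<noteq> 0"
    proof
      assume *: "x + y * \<beta> - y * z = 0"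
      show False
      proof (cases "y = 0")
        case True
        then show False using * \<open>u \<noteq> 0\<close> u by simp
      next
        case False
        then have "z = (x + y * \<beta>) / y" using * by (simp add: field_simps)
        then show False using assms u by auto
      qed
    qed
    then have "N \<noteq> 0" using N \<open>u \<noteq> 0\<close> by auto
    then have "inverse u = (x + y * \<beta> - y * z) / N"
      by (intro inverse_unique) (simp only: times_divide_eq_right N, simp)
    also have "\<dots> = (- y / N) * z + (x + y * \<beta>) / N"
      by (simp add: diff_divide_distrib add_divide_distrib)
    finally have "inverse u = (- y / N) * z + (x + y * \<beta>) / N" .
    moreover have "N \<in> K" unfolding N_def using u assms(2,3) by auto
    ultimately show "inverse u \<in> E" unfolding E_iff using u(1,2) assms(2,3)
      by (intro bexI[of _ "- y / N"] bexI[of _ "(x + y * \<beta>) / N"]) auto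
  qed
  moreover have "z \<in> E" unfolding E_iff by (intro bexI[of _ 1] bexI[of _ 0]) auto
  moreover have "K \<subseteq> E" unfolding E_iff subset_iff by (metis add_0 mult_zero_left zero_one_in_field(1))
  ultimately have "adjoin \<Delta> z \<subseteq> E" by (intro adjoin_minimal)
  moreover have "E \<subseteq> adjoin \<Delta> z"
    using adjoin_closed by (auto simp: E_iff)
  ultimately have "adjoin \<Delta> z = E" by blast
  moreover have "CR.dimension (Suc 1) K E" unfolding E_def
    using assms(1) CR.dimension_one[OF subfield_K] by (intro CR.Suc_dim) (auto simp: type_ring_simps)
  ultimately show ?thesis by (simp add: has_degree_def numeral_2_eq_2)
qed

lemma has_degree_le_2_iff:
  "(\<exists>d\<le>2. has_degree \<Delta> z d) \<longleftrightarrow> z \<in> K \<or> has_degree \<Delta> z 2"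
proof -
  have "(\<exists>d\<le>2. has_degree \<Delta> z d) \<longleftrightarrow> has_degree \<Delta> z 0 \<or> has_degree \<Delta> z 1 \<or> has_degree \<Delta> z 2"
    by (auto simp: le_Suc_eq numeral_2_eq_2)
  then show ?thesis using not_has_degree_0 has_degree_1_iff by simp
qed

lemma quadratic_relation_imp_degree:
  assumes "A \<in> K" "B \<in> K" "C \<in> K" "A * (z * z) + B * z + C = 0" "A \<noteq> 0 \<or> B \<noteq> 0 \<or> C \<noteq> 0"
  shows "z \<in> K \<or> has_degree \<Delta> z 2"
proof (cases "A = 0")
  case True
  then have "B \<noteq> 0" using assms by auto
  moreover have "B * z = - C" using assms True by (simp add: eq_neg_iff_add_eq_0)
  ultimately have "z = - C / B" by (metis nonzero_mult_div_cancel_left)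
  then show ?thesis using assms by blast
next
  case False
  have "z * z - ((- B / A) * z + (- C / A)) = (A * (z * z) + B * z + C) / A"
    using False by (simp add: field_simps)
  then have "z * z = (- B / A) * z + (- C / A)" using assms(4) by simp
  then show ?thesis using has_degree_2I[of z "- B / A" "- C / A"] assms by blast
qed

lemma has_degree_2_integral:
  assumes "has_degree \<Delta> z 2"
  obtains A B C where "A \<in> R" "B \<in> R" "C \<in> R" "A \<noteq> 0" "A * (z * z) + B * z + C = 0"
proof -
  obtain \<beta> \<gamma> where bc: "\<beta> \<in> K" "\<gamma> \<in> K" "z * z = \<beta> * z + \<gamma>" using has_degree_2D(2)[OF assms] by blast
  obtain d where d: "d \<in> R" "d \<noteq> 0" "d * \<beta> \<in> R" using fieldE bc(1) by blast
  obtain e where e: "e \<in> R" "e \<noteq> 0" "e * \<gamma> \<in> R" using fieldE bc(2) by blast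
  show ?thesis
  proof (rule that[of "d * e" "- (e * (d * \<beta>))" "- (d * (e * \<gamma>))"])
    show "d * e * (z * z) + - (e * (d * \<beta>)) * z + - (d * (e * \<gamma>)) = 0"
      unfolding bc(3) by (simp add: algebra_simps)
  qed (use d e in auto)
qed

end

section \<open>Errors and finiteness of an expansion\<close>

lemma cf_mat_Suc_nth:
  "cf_mat a b (Suc n) $ i $ 1 = (a (Suc n) * cf_mat a b n $ i $ 1 + b (Suc n) * cf_mat a b n $ i $ 2) / b n"
  "cf_mat a b (Suc n) $ i $ 2 = cf_mat a b n $ i $ 1"
  by (simp_all add: matrix_matrix_mult_def sum_2 S_mat_def add_divide_distrib mult.commute)

text \<open>The inverse is the adjugate over the determinant, which cancels in the Moebius quotient;
  what remains is the negated ratio of the errors of the two columns.\<close>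

lemma moebius_matrix_inv:
  fixes M :: "complex^2^2"
  assumes "det M \<noteq> 0"
  shows "moebius (matrix_inv M) z =
    (if M $ 2 $ 1 * z - M $ 1 $ 1 = 0 then None
     else Some (- (M $ 2 $ 2 * z - M $ 1 $ 2) / (M $ 2 $ 1 * z - M $ 1 $ 1)))"
proof -
  define D where "D = M $ 1 $ 1 * M $ 2 $ 2 - M $ 1 $ 2 * M $ 2 $ 1"
  have D: "D \<noteq> 0" using assms by (simp add: D_def det_2)
  define N :: "complex^2^2" where
    "N = vector [vector [M $ 2 $ 2 / D, - M $ 1 $ 2 / D], vector [- M $ 2 $ 1 / D, M $ 1 $ 1 / D]]"
  have N: "N $ 1 $ 1 = M $ 2 $ 2 / D" "N $ 1 $ 2 = - M $ 1 $ 2 / D"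
    "N $ 2 $ 1 = - M $ 2 $ 1 / D" "N $ 2 $ 2 = M $ 1 $ 1 / D"
    by (simp_all add: N_def)
  have "M ** N = mat 1"
    using D by (simp add: vec_eq_iff forall_2 matrix_matrix_mult_def sum_2 N mat_def field_simps)
      (simp add: D_def algebra_simps)
  moreover from this have "N ** M = mat 1" by (simp add: matrix_left_right_inverse)
  \<comment> \<open>\<open>matrix_inv\<close> is defined by choice; uniqueness of a two-sided
    inverse pins it down.\<close>
  ultimately have inv: "matrix_inv M = N"
    unfolding matrix_inv_def
    by (intro some_equality) (auto, metis matrix_mul_assoc matrix_mul_lid matrix_mul_rid)
  define u where "u = M $ 2 $ 1 * z - M $ 1 $ 1"
  define v where "v = M $ 2 $ 2 * z - M $ 1 $ 2"
  have "N $ 2 $ 1 * z + N $ 2 $ 2 = - u / D" "N $ 1 $ 1 * z + N $ 1 $ 2 = v / D"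
    by (simp_all add: N u_def v_def diff_divide_distrib)
  then have "moebius (matrix_inv M) z = (if u = 0 then None else Some (- v / u))"
    using D by (simp add: inv moebius_def)
  then show ?thesis by (simp only: u_def v_def)
qed

lemma finite_quadratic_roots:
  fixes A B C :: complex
  assumes "A \<noteq> 0"
  shows "finite {w. A * (w * w) + B * w + C = 0}"
proof -
  have "finite {w. poly [:C, B, A:] w = 0}" by (rule poly_roots_finite) (use assms in simp)
  then show ?thesis by (simp add: algebra_simps)
qed

locale cf_run = imag_quad_order +
  fixes B :: "complex set" and \<epsilon> :: real and z :: complex and a b :: "nat \<Rightarrow> complex"
  assumes finite_B: "finite B" and B_sub: "B \<subseteq> R - {0}" and eps: "0 < \<epsilon>" "\<epsilon> < 1"
    and expansion: "cf_expansion \<Delta> B \<epsilon> z a b"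
begin

abbreviation "reached n \<equiv> cf_reaches z a b n"

text \<open>\<open>(p n, q n)\<close> and \<open>(p' n, q' n)\<close> are the columns of \<open>M\<^sub>n\<close>, and \<open>z\<^sub>n = - e' n / e n\<close>.\<close>

definition p where "p n = cf_mat a b n $ 1 $ 1"
definition p' where "p' n = cf_mat a b n $ 1 $ 2"
definition q where "q n = cf_mat a b n $ 2 $ 1"
definition q' where "q' n = cf_mat a b n $ 2 $ 2"
definition e where "e n = q n * z - p n"
definition e' where "e' n = q' n * z - p' n"

lemma entries_0 [simp]: "p 0 = 1" "p' 0 = 0" "q 0 = 0" "q' 0 = 1" "e 0 = - 1" "e' 0 = z"
  by (simp_all add: p_def p'_def q_def q'_def e_def e'_def mat_def)

lemma entries_Suc:
  "p (Suc n) = (a (Suc n) * p n + b (Suc n) * p' n) / b n" "p' (Suc n) = p n"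
  "q (Suc n) = (a (Suc n) * q n + b (Suc n) * q' n) / b n" "q' (Suc n) = q n"
  by (simp_all only: p_def p'_def q_def q'_def cf_mat_Suc_nth)

lemma errors_Suc:
  "e (Suc n) = (a (Suc n) * e n + b (Suc n) * e' n) / b n" "e' (Suc n) = e n"
  by (simp_all add: e_def e'_def entries_Suc diff_divide_distrib[symmetric] algebra_simps)

lemma reached_0 [simp]: "reached 0"
  by (simp add: cf_reaches_def)

lemma reached_mono: "reached n \<Longrightarrow> m \<le> n \<Longrightarrow> reached m"
  by (auto simp: cf_reaches_def)

lemma b_0 [simp]: "b 0 = 1"
  using expansion by (simp add: cf_expansion_def)

lemma stepD:
  assumes "reached (Suc n)"
  shows "b (Suc n) \<in> B" "a (Suc n) \<in> R"
    "\<exists>w. cf_z z a b n = Some w \<and> cmod (a (Suc n) - b (Suc n) * w) \<le> \<epsilon> * cmod (b n)"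
    "reduced_ideal \<Delta> (ideal_gen2 \<Delta> (p (Suc n)) (q (Suc n)))"
  using expansion assms
  by (auto simp: cf_expansion_def col1_ideal_def p_def q_def dist_norm norm_minus_commute
           simp del: cf_mat.simps)

lemma b_in: "reached n \<Longrightarrow> b n \<in> R \<and> b n \<noteq> 0"
  using stepD(1) B_sub by (cases n) auto

lemma b_bounded:
  "\<exists>\<beta>. \<forall>n. reached n \<longrightarrow> 1 \<le> cmod (b n) \<and> cmod (b n) \<le> \<beta>"
proof (intro exI allI impI)
  fix n assume n: "reached n"
  have "b n \<in> insert 1 B" using n stepD(1) by (cases n) auto
  then show "1 \<le> cmod (b n) \<and> cmod (b n) \<le> Max (cmod ` insert 1 B)"
    using b_in[OF n] cmod_ge_1 finite_B by (auto intro!: Max_ge)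
qed

text \<open>Each step multiplies the determinant by \<open>- b (Suc n) / b n\<close>, so the
  quotients telescope.\<close>

lemma det_eq: "reached n \<Longrightarrow> p n * q' n - p' n * q n = (- 1) ^ n * b n"
proof (induction n)
  case (Suc n)
  then have "reached n" using reached_mono le_SucI by blast
  then have "p n * q' n - p' n * q n = (- 1) ^ n * b n" "b n \<noteq> 0" using Suc.IH b_in by auto
  moreover have "p (Suc n) * q' (Suc n) - p' (Suc n) * q (Suc n)
      = - (b (Suc n) / b n) * (p n * q' n - p' n * q n)"
    by (simp add: entries_Suc diff_divide_distrib[symmetric] algebra_simps)
  ultimately show ?case by simp
qed simp

lemma det_nz: "reached n \<Longrightarrow> p n * q' n - p' n * q n \<noteq> 0"
  using det_eq b_in by simp

text \<open>The recurrence divides by \<open>b n\<close>, so integrality comes instead from the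
  first column generating a reduced, hence integral, ideal.\<close>

lemma entries_in: "reached n \<Longrightarrow> p n \<in> R \<and> q n \<in> R \<and> p' n \<in> R \<and> q' n \<in> R"
proof (induction n)
  case (Suc n)
  then have "reached n" using reached_mono le_SucI by blast
  moreover have "ideal_gen2 \<Delta> (p (Suc n)) (q (Suc n)) \<subseteq> R"
    using stepD(4)[OF Suc.prems] by (auto simp: reduced_ideal_def integral_ideal_def)
  then have "p (Suc n) \<in> R" "q (Suc n) \<in> R" using ideal_gen2_mem by blast+
  ultimately show ?case using Suc.IH by (auto simp: entries_Suc(2,4))
qed simp

lemma stops_iff: "reached n \<Longrightarrow> cf_stops z a b n \<longleftrightarrow> e n = 0"
  using det_nz[of n] unfolding cf_stops_def p_def[symmetric] q_def[symmetric] e_def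
  by (cases "q n = 0") (auto simp: field_simps)

lemma reached_Suc: "reached (Suc n) \<longleftrightarrow> reached n \<and> e n \<noteq> 0"
  using stops_iff by (auto simp: cf_reaches_def less_Suc_eq)

lemma cf_z_eq:
  assumes "reached n"
  shows "cf_z z a b n = (if e n = 0 then None else Some (- e' n / e n))"
proof -
  have "det (cf_mat a b n) \<noteq> 0"
    using det_nz[OF assms] by (simp add: det_2 p_def p'_def q_def q'_def)
  from moebius_matrix_inv[OF this, of z] show ?thesis
    by (simp add: cf_z_def e_def e'_def p_def p'_def q_def q'_def)
qed

text \<open>The new error is \<open>e n * (a (Suc n) - b (Suc n) * w) / b n\<close> for the finite
  tail \<open>w\<close>, and the choice of \<open>a (Suc n)\<close> bounds the middle
  factor.\<close>

lemma error_step: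
  assumes "reached (Suc n)"
  shows "cmod (e (Suc n)) \<le> \<epsilon> * cmod (e n)"
proof -
  have n: "reached n" "e n \<noteq> 0" "b n \<noteq> 0" using assms b_in by (auto simp: reached_Suc)
  obtain w where w: "w = - e' n / e n" "cmod (a (Suc n) - b (Suc n) * w) \<le> \<epsilon> * cmod (b n)"
    using stepD(3)[OF assms] cf_z_eq[OF n(1)] n by auto
  have "e n * w = - e' n" using n(2) by (simp add: w(1))
  moreover have "e n * (a (Suc n) - b (Suc n) * w) = a (Suc n) * e n - b (Suc n) * (e n * w)"
    by (simp add: algebra_simps)
  ultimately have "e (Suc n) = e n * (a (Suc n) - b (Suc n) * w) / b n"
    by (simp add: errors_Suc)
  then have "cmod (e (Suc n)) = cmod (e n) * cmod (a (Suc n) - b (Suc n) * w) / cmod (b n)"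
    by (simp add: norm_mult norm_divide)
  also have "\<dots> \<le> cmod (e n) * (\<epsilon> * cmod (b n)) / cmod (b n)"
    by (intro divide_right_mono mult_left_mono w) auto
  also have "\<dots> = \<epsilon> * cmod (e n)" using n by simp
  finally show ?thesis .
qed

section \<open>Decay of errors against growth of denominators\<close>

lemma error_decay: "reached (n + k) \<Longrightarrow> cmod (e (n + k)) \<le> \<epsilon> ^ k * cmod (e n)"
proof (induction k)
  case (Suc k)
  then have "cmod (e (n + k)) \<le> \<epsilon> ^ k * cmod (e n)" by (simp add: reached_Suc)
  moreover have "cmod (e (n + Suc k)) \<le> \<epsilon> * cmod (e (n + k))"
    using error_step[of "n + k"] Suc.prems by simp
  ultimately show ?case using eps
    by (smt (verit, best) mult.assoc mult_left_mono power_Suc)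
qed simp

lemma error_le_power: "reached n \<Longrightarrow> cmod (e n) \<le> \<epsilon> ^ n"
  using error_decay[of 0 n] by simp

lemma error_le_1: "reached n \<Longrightarrow> cmod (e n) \<le> 1"
  using error_le_power[of n] eps power_le_one[of \<epsilon> n] by linarith

lemma cross_relation: "reached n \<Longrightarrow> q n * e' n - q' n * e n = (- 1) ^ n * b n"
  unfolding det_eq[symmetric] e_def e'_def by (simp add: algebra_simps)

text \<open>The determinant trades \<open>q n * e' n\<close> for \<open>q' n * e n\<close> up to a
  bounded term; with the contraction of errors this bounds \<open>q (Suc n) * e (Suc n)\<close> by a
  contracting affine function of \<open>q n * e n\<close>.\<close>

lemma error_products_bounded:
  obtains C where "C \<ge> 1" "\<And>n. reached n \<Longrightarrow> cmod (q n * e n) \<le> C"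
    "\<And>n. reached n \<Longrightarrow> cmod (q' n * e n) \<le> C" "\<And>n. reached n \<Longrightarrow> cmod (q n * e' n) \<le> C"
    "\<And>n. reached n \<Longrightarrow> cmod (q' n * e' n) \<le> C" "\<And>n. reached n \<Longrightarrow> cmod (e' n) \<le> C"
proof -
  obtain \<beta> where \<beta>: "\<And>n. reached n \<Longrightarrow> 1 \<le> cmod (b n) \<and> cmod (b n) \<le> \<beta>" using b_bounded by blast
  have \<beta>1: "1 \<le> \<beta>" using \<beta>[of 0] by simp
  \<comment> \<open>\<open>Y\<close> is the fixed point of
    \<open>x \<mapsto> \<beta> + \<epsilon> * x\<close>, so the bound reproduces itself in the
    induction.\<close>
  define Y :: real where "Y = \<beta> / (1 - \<epsilon>)"
  have Y: "\<beta> = Y * (1 - \<epsilon>)" using eps by (simp add: Y_def)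
  have Y1: "\<beta> \<le> Y" using eps \<beta>1 by (simp add: Y_def le_divide_eq)
  have cross: "cmod (q n * e' n) \<le> \<beta> + cmod (q' n * e n)" if "reached n" for n
  proof -
    have "q n * e' n = (- 1) ^ n * b n + q' n * e n" using cross_relation[OF that] by (simp only: diff_eq_eq)
    then have "cmod (q n * e' n) \<le> cmod ((- 1) ^ n * b n) + cmod (q' n * e n)"
      using norm_triangle_ineq by metis
    then show ?thesis using \<beta>[OF that] by (simp add: norm_mult norm_power)
  qed
  have shift: "cmod (q' (Suc n) * e (Suc n)) \<le> \<epsilon> * cmod (q n * e n)" if "reached (Suc n)" for n
    using mult_left_mono[OF error_step[OF that], of "cmod (q n)"]
    by (simp add: entries_Suc norm_mult mult_ac)
  have qe: "cmod (q n * e n) \<le> Y" if "reached n" for n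
    using that
  proof (induction n)
    case 0
    then show ?case using Y1 \<beta>1 by simp
  next
    case (Suc n)
    then have IH: "cmod (q n * e n) \<le> Y" by (simp add: reached_Suc)
    have "cmod (q (Suc n) * e (Suc n)) \<le> \<epsilon> * cmod (q (Suc n) * e' (Suc n))"
      using mult_left_mono[OF error_step[OF Suc.prems], of "cmod (q (Suc n))"]
      by (simp add: errors_Suc(2) norm_mult mult_ac)
    also have "\<dots> \<le> \<epsilon> * (\<beta> + \<epsilon> * Y)"
      using cross[OF Suc.prems] shift[OF Suc.prems] mult_left_mono[OF IH, of \<epsilon>] eps
      by (intro mult_left_mono) linarith+
    also have "\<dots> = \<epsilon> * Y" by (simp add: Y algebra_simps)
    also have "\<dots> \<le> Y" using eps Y1 \<beta>1 by (simp add: mult_left_le_one_le)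
    finally show ?case .
  qed
  have q'e: "cmod (q' n * e n) \<le> Y" if "reached n" for n
  proof (cases n)
    case 0
    then show ?thesis using Y1 \<beta>1 by simp
  next
    case (Suc m)
    then have "reached m" using that by (simp add: reached_Suc)
    then have "\<epsilon> * cmod (q m * e m) \<le> 1 * Y" using qe eps by (intro mult_mono) auto
    then show ?thesis using shift[of m] that Suc by simp
  qed
  \<comment> \<open>The summand \<open>cmod z\<close> covers index 0, where
    \<open>e' 0 = z\<close>.\<close>
  show ?thesis
  proof (rule that[of "\<beta> + Y + cmod z"])
    show "1 \<le> \<beta> + Y + cmod z" using Y1 \<beta>1 norm_ge_zero[of z] by linarith
    fix n assume n: "reached n"
    show "cmod (q n * e n) \<le> \<beta> + Y + cmod z" using qe[OF n] \<beta>1 norm_ge_zero[of z] by linarith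
    show "cmod (q' n * e n) \<le> \<beta> + Y + cmod z" using q'e[OF n] \<beta>1 norm_ge_zero[of z] by linarith
    show "cmod (q n * e' n) \<le> \<beta> + Y + cmod z"
      using q'e[OF n] cross[OF n] norm_ge_zero[of z] by linarith
    show "cmod (q' n * e' n) \<le> \<beta> + Y + cmod z"
    proof (cases n)
      case 0
      then show ?thesis using Y1 \<beta>1 by simp
    next
      case (Suc m)
      then have "cmod (q m * e m) \<le> Y" using qe n by (simp add: reached_Suc)
      then show ?thesis unfolding Suc entries_Suc errors_Suc(2) using \<beta>1 norm_ge_zero[of z] by linarith
    qed
    show "cmod (e' n) \<le> \<beta> + Y + cmod z"
    proof (cases n)
      case 0
      then show ?thesis using Y1 \<beta>1 by simp
    next
      case (Suc m)
      then have "cmod (e m) \<le> 1" using error_le_1 n by (simp add: reached_Suc)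
      then show ?thesis using Suc \<beta>1 Y1 norm_ge_zero[of z] unfolding Suc errors_Suc(2) by linarith
    qed
  qed
qed

section \<open>Stopping runs and points of the field\<close>

lemma infinite_iff: "cf_infinite z a b \<longleftrightarrow> (\<forall>n. reached n)"
  by (auto simp: cf_infinite_def cf_reaches_def)

lemma stops_in_field: "cf_stops z a b n \<Longrightarrow> reached n \<Longrightarrow> z \<in> K"
  using entries_in ring_subset_field
  by (auto simp: cf_stops_def p_def[symmetric] q_def[symmetric])

lemma not_infinite_in_field:
  assumes "\<not> cf_infinite z a b"
  shows "z \<in> K"
proof -
  obtain n where "cf_stops z a b n" "\<forall>m<n. \<not> cf_stops z a b m"
    using assms unfolding cf_infinite_def by (metis exists_least_iff)
  then show ?thesis using stops_in_field by (auto simp: cf_reaches_def)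
qed

text \<open>If \<open>s\<close> clears the denominator of \<open>z\<close>, each
  \<open>s * e n\<close> of an infinite run is a nonzero element of the order, so of modulus at
  least 1, against the geometric decay.\<close>

lemma in_field_not_infinite:
  assumes "z \<in> K"
  shows "\<not> cf_infinite z a b"
proof
  assume "cf_infinite z a b"
  then have reached: "reached n" for n by (simp add: infinite_iff)
  obtain s where s: "s \<in> R" "s \<noteq> 0" "s * z \<in> R" using fieldE assms by blast
  have "1 \<le> cmod s * \<epsilon> ^ n" for n
  proof -
    have "s * e n = q n * (s * z) - s * p n" by (simp add: e_def algebra_simps)
    also have "\<dots> \<in> R" using s entries_in[OF reached[of n]] by auto
    finally have "1 \<le> cmod (s * e n)"
      using s reached[of "Suc n"] by (intro cmod_ge_1) (auto simp: reached_Suc)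
    also have "\<dots> \<le> cmod s * \<epsilon> ^ n"
      using error_le_power[OF reached[of n]] by (simp add: norm_mult mult_left_mono)
    finally show ?thesis .
  qed
  moreover obtain n where "\<epsilon> ^ n < 1 / cmod s"
    using real_arch_pow_inv[of "1 / cmod s" \<epsilon>] eps s by auto
  then have "cmod s * \<epsilon> ^ n < 1" using s by (simp add: field_simps)
  ultimately show False by (meson not_le)
qed

lemma not_infinite_finite:
  assumes "\<not> cf_infinite z a b"
  shows "finite {cf_z z a b n | n. reached n}"
proof -
  obtain N where "\<not> reached N" using assms by (auto simp: infinite_iff)
  then have "{n. reached n} \<subseteq> {..N}" using reached_mono nat_le_linear by blast
  then have "finite (cf_z z a b ` {n. reached n})" by (meson finite_imageI finite_subset finite_atMost)
  moreover have "{cf_z z a b n | n. reached n} = cf_z z a b ` {n. reached n}" by blast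
  ultimately show ?thesis by simp
qed

section \<open>Finitely many tails and degree two\<close>

lemma degree_2_finite:
  assumes "has_degree \<Delta> z 2"
  shows "finite {cf_z z a b n | n. reached n}"
proof -
  obtain A F G where f: "A \<in> R" "F \<in> R" "G \<in> R" "A \<noteq> 0" "A * (z * z) + F * z + G = 0"
    using has_degree_2_integral[OF assms] .
  have zK: "z \<notin> K" using has_degree_2D(1)[OF assms] .
  obtain C where C: "C \<ge> 1" "\<And>n. reached n \<Longrightarrow> cmod (q n * e n) \<le> C"
    "\<And>n. reached n \<Longrightarrow> cmod (q' n * e n) \<le> C" "\<And>n. reached n \<Longrightarrow> cmod (q n * e' n) \<le> C"
    "\<And>n. reached n \<Longrightarrow> cmod (q' n * e' n) \<le> C" "\<And>n. reached n \<Longrightarrow> cmod (e' n) \<le> C"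
    by (rule error_products_bounded) blast
  \<comment> \<open>\<open>L\<close> is the derivative at \<open>z\<close> of the polynomial with
    coefficients \<open>A\<close>, \<open>F\<close>, \<open>G\<close>.\<close>
  define L where "L = 2 * A * z + F"
  \<comment> \<open>\<open>A'\<close>, \<open>F'\<close>, \<open>G'\<close> are the coefficients of
    the binary form \<open>A * X^2 + F * X * Y + G * Y^2\<close> after substituting the matrix
    \<open>cf_mat a b n\<close>.\<close>
  define A' where "A' n = A * (p n * p n) + F * (p n * q n) + G * (q n * q n)" for n
  define F' where "F' n = 2 * A * (p n * p' n) + F * (p n * q' n + p' n * q n) + 2 * G * (q n * q' n)" for n
  define G' where "G' n = A * (p' n * p' n) + F * (p' n * q' n) + G * (q' n * q' n)" for n
  define r where "r = 2 * cmod A * (C * C) + cmod L * (2 * C)"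
  define T where "T = {u \<in> R. cmod u \<le> r}"
  have G: "G = - (A * (z * z) + F * z)" using f(5) by (metis add.commute eq_neg_iff_add_eq_0)
  \<comment> \<open>Substituting \<open>p = q z - e\<close> cancels the large terms because \<open>z\<close> is a root.\<close>
  have A': "A' n = A * (e n * e n) - L * (q n * e n)" for n
    unfolding A'_def L_def G e_def by (simp add: algebra_simps)
  have F': "F' n = 2 * A * (e n * e' n) - L * (q n * e' n + q' n * e n)" for n
    unfolding F'_def L_def G e_def e'_def by (simp add: algebra_simps)
  have G': "G' n = A * (e' n * e' n) - L * (q' n * e' n)" for n
    unfolding G'_def L_def G e'_def by (simp add: algebra_simps)
  have two: "2 \<in> R" using of_int_in_ring[of 2] by simp
  have mem: "A' n \<in> T \<and> F' n \<in> T \<and> G' n \<in> T" if n: "reached n" for n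
  proof -
    have eC: "cmod (e n) \<le> C" using error_le_1[OF n] C(1) by linarith
    have "A' n \<in> R" "F' n \<in> R" "G' n \<in> R"
      unfolding A'_def F'_def G'_def using f entries_in[OF n] two by (auto intro!: ring_add ring_mult)
    moreover have "cmod (A' n) \<le> r"
    proof -
      have "cmod (A' n) \<le> cmod (A * (e n * e n)) + cmod (L * (q n * e n))"
        unfolding A' by (rule norm_triangle_ineq4)
      also have "\<dots> \<le> cmod A * (C * C) + cmod L * C"
        unfolding norm_mult[of A] norm_mult[of "e n"] norm_mult[of L]
        using eC C(2)[OF n] C(1) by (intro add_mono mult_left_mono mult_mono) auto
      also have "\<dots> \<le> r" using C(1) by (simp add: r_def)
      finally show ?thesis .
    qed
    moreover have "cmod (G' n) \<le> r"
    proof -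
      have "cmod (G' n) \<le> cmod (A * (e' n * e' n)) + cmod (L * (q' n * e' n))"
        unfolding G' by (rule norm_triangle_ineq4)
      also have "\<dots> \<le> cmod A * (C * C) + cmod L * C"
        unfolding norm_mult[of A] norm_mult[of "e' n"] norm_mult[of L]
        using C(5,6)[OF n] C(1) by (intro add_mono mult_left_mono mult_mono) auto
      also have "\<dots> \<le> r" using C(1) by (simp add: r_def)
      finally show ?thesis .
    qed
    moreover have "cmod (F' n) \<le> r"
    proof -
      have "cmod (F' n) \<le> cmod (2 * A * (e n * e' n)) + cmod (L * (q n * e' n + q' n * e n))"
        unfolding F' by (rule norm_triangle_ineq4)
      also have "\<dots> \<le> 2 * cmod A * (C * C) + cmod L * (2 * C)"
        unfolding norm_mult[of "2 * A"] norm_mult[of 2] norm_mult[of "e n"] norm_mult[of L]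
        using eC C(3,4,6)[OF n] C(1) norm_triangle_ineq[of "q n * e' n" "q' n * e n"]
        by (intro add_mono mult_left_mono mult_mono) auto
      finally show ?thesis by (simp add: r_def)
    qed
    ultimately show ?thesis by (simp add: T_def)
  qed
  have root: "A' n * (w * w) + F' n * w + G' n = 0" if "reached n" "e n \<noteq> 0" "w = - e' n / e n" for n w
  proof -
    have "w * e n = - e' n" using that by simp
    then have "e' n = - (w * e n)" by simp
    then show ?thesis unfolding A' F' G' by (simp add: algebra_simps)
  qed
  \<comment> \<open>If \<open>A' n\<close> vanished, cancelling \<open>e n\<close> would leave a
    linear equation for \<open>z\<close> over \<open>K\<close> with leading coefficient
    \<open>A * q n\<close>, or \<open>A * e n = 0\<close> when \<open>q n = 0\<close>.\<close>
  have A'_nz: "A' n \<noteq> 0" if n: "reached n" "e n \<noteq> 0" for n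
  proof
    assume "A' n = 0"
    then have 1: "A * e n = L * q n" using n(2) by (simp add: A' algebra_simps) 
    show False
    proof (cases "q n = 0")
      case True
      then show False using 1 n f by simp
    next
      case False
      have "z * (A * q n) = - (A * p n + F * q n)"
        using 1 by (simp add: e_def L_def algebra_simps eq_neg_iff_add_eq_0)
      then have "z = - (A * p n + F * q n) / (A * q n)"
        using False f by (metis mult_eq_0_iff nonzero_mult_div_cancel_right)
      moreover have "A \<in> K" "F \<in> K" "p n \<in> K" "q n \<in> K"
        using f entries_in[OF n(1)] ring_subset_field by auto
      ultimately show False using zK by (metis field_add field_divide field_mult field_uminus)
    qed
  qed
  have "{cf_z z a b n | n. reached n} \<subseteq> insert None (Some `
     (\<Union>(A, F, G) \<in> (T - {0}) \<times> T \<times> T. {w. A * (w * w) + F * w + G = 0}))"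
  proof clarify
    fix n assume n: "reached n" "cf_z z a b n \<notin> Some `
     (\<Union>(A, F, G) \<in> (T - {0}) \<times> T \<times> T. {w. A * (w * w) + F * w + G = 0})"
    show "cf_z z a b n = None"
    proof (cases "e n = 0")
      case True
      then show ?thesis using cf_z_eq[OF n(1)] by simp
    next
      case False
      let ?w = "- e' n / e n"
      have "?w \<in> (\<Union>(A, F, G) \<in> (T - {0}) \<times> T \<times> T. {w. A * (w * w) + F * w + G = 0})"
        using mem[OF n(1)] A'_nz[OF n(1) False] root[OF n(1) False refl]
        by (intro UN_I[of "(A' n, F' n, G' n)"]) auto
      then show ?thesis using n(2) cf_z_eq[OF n(1)] False by simp
    qed
  qed
  moreover have "finite T" unfolding T_def by (rule finite_ring_bounded)
  then have "finite (\<Union>(A, F, G) \<in> (T - {0}) \<times> T \<times> T. {w. A * (w * w) + F * w + G = 0})"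
    using finite_quadratic_roots by (intro finite_UN_I) auto
  ultimately show ?thesis by (meson finite_imageI finite_insert finite_subset)
qed

text \<open>Since \<open>(- 1, z) M\<^sub>n = (e\<^sub>n, e'\<^sub>n)\<close>, equality of \<open>z\<^sub>n\<close> and \<open>z\<^sub>m\<close> makes \<open>(- 1, z)\<close> a left
  eigenvector of \<open>M\<^sub>m M\<^sub>n\<^sup>-\<^sup>1\<close>.\<close>

lemma transition_eigenvector:
  assumes n: "reached (Suc n)" and m: "reached (Suc m)" and eq: "cf_z z a b n = cf_z z a b m"
    and g: "p m = g11 * p n + g12 * q n" "p' m = g11 * p' n + g12 * q' n"
      "q m = g21 * p n + g22 * q n" "q' m = g21 * p' n + g22 * q' n"
  shows "g21 * z - g11 = - (e m / e n)" "g22 * z - g12 = e m / e n * z"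
proof -
  define l where "l = e m / e n"
  have nm: "reached n" "e n \<noteq> 0" "reached m" "e m \<noteq> 0" using n m by (auto simp: reached_Suc)
  have e: "e m = l * e n" using nm by (simp add: l_def)
  have "- e' m / e m = - e' n / e n" using eq nm cf_z_eq by simp
  then have e': "e' m = l * e' n" using nm by (simp add: l_def field_simps)
  \<comment> \<open>The row \<open>(U, V)\<close> is the defect of the eigenvector equation for
    \<open>(- 1, z)\<close>; its product with the invertible matrix at \<open>n\<close> is zero, so
    it vanishes.\<close>
  define U where "U = g21 * z - g11 + l"
  define V where "V = g22 * z - g12 - l * z"
  have 1: "p n * U + q n * V = 0"
    using e unfolding e_def g U_def V_def by (simp add: algebra_simps)
  have 2: "p' n * U + q' n * V = 0"
    using e' unfolding e'_def g U_def V_def by (simp add: algebra_simps)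
  have "(p n * q' n - p' n * q n) * U = q' n * (p n * U + q n * V) - q n * (p' n * U + q' n * V)"
    "(p n * q' n - p' n * q n) * V = p n * (p' n * U + q' n * V) - p' n * (p n * U + q n * V)"
    by (simp_all add: algebra_simps)
  then have "U = 0" "V = 0" using 1 2 det_nz[OF nm(1)] by auto
  then show "g21 * z - g11 = - (e m / e n)" "g22 * z - g12 = e m / e n * z"
    by (simp_all add: U_def V_def l_def add_eq_0_iff2)
qed

text \<open>In an infinite run some tail recurs arbitrarily late, where the eigenvalue is too small
  for a scalar transition matrix; the fixed-point equation is then nontrivial.\<close>

lemma finite_imp_degree:
  assumes "finite {cf_z z a b n | n. reached n}"
  shows "z \<in> K \<or> has_degree \<Delta> z 2"
proof (cases "cf_infinite z a b")
  case False
  then show ?thesis using not_infinite_in_field by blast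
next
  case True
  then have reached: "reached n" for n by (simp add: infinite_iff)
  then have e_nz: "e n \<noteq> 0" for n using reached_Suc by blast
  have "finite (range (cf_z z a b))"
    using assms reached by (simp add: full_SetCompr_eq)
  then obtain n where inf: "infinite {m. cf_z z a b m = cf_z z a b n}"
    using pigeonhole_infinite[of "UNIV :: nat set" "cf_z z a b"] by auto
  obtain \<beta> where \<beta>: "\<And>n. reached n \<Longrightarrow> 1 \<le> cmod (b n) \<and> cmod (b n) \<le> \<beta>" using b_bounded by blast
  have \<beta>1: "1 \<le> \<beta>" using \<beta>[of 0] by simp
  \<comment> \<open>Once \<open>cmod l < 1 / \<beta>\<close>, a scalar matrix would give
    \<open>cmod (b m) = (cmod l)^2 * cmod (b n) < 1\<close>, but each \<open>b m\<close> has modulus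
    at least 1.\<close>
  obtain k where k: "\<epsilon> ^ k < 1 / \<beta>" using real_arch_pow_inv[of "1 / \<beta>" \<epsilon>] eps \<beta>1 by auto
  obtain m where m: "m \<ge> n + k" "cf_z z a b m = cf_z z a b n"
    using inf unfolding infinite_nat_iff_unbounded_le by blast
  define l where "l = e m / e n"
  have "cmod (e m) \<le> \<epsilon> ^ (m - n) * cmod (e n)"
    using error_decay[of n "m - n"] m(1) reached by simp
  then have "cmod l \<le> \<epsilon> ^ (m - n)" using e_nz[of n] by (simp add: l_def norm_divide field_simps)
  also have "\<dots> \<le> \<epsilon> ^ k" using m(1) eps by (intro power_decreasing) auto
  finally have l: "cmod l < 1 / \<beta>" using k by simp
  have l1: "cmod l \<le> 1" using l \<beta>1 by (smt (verit) divide_le_eq_1_pos)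
  define D where "D = p n * q' n - p' n * q n"
  have D: "D \<noteq> 0" using det_nz reached by (simp add: D_def)
  define g11 where "g11 = (p m * q' n - p' m * q n) / D"
  define g12 where "g12 = (p n * p' m - p' n * p m) / D"
  define g21 where "g21 = (q m * q' n - q' m * q n) / D"
  define g22 where "g22 = (p n * q' m - p' n * q m) / D"
  have g: "p m = g11 * p n + g12 * q n" "p' m = g11 * p' n + g12 * q' n"
    "q m = g21 * p n + g22 * q n" "q' m = g21 * p' n + g22 * q' n"
    unfolding g11_def g12_def g21_def g22_def using D
    by (simp_all add: field_simps) (simp_all add: D_def algebra_simps)
  have K: "g11 \<in> K" "g12 \<in> K" "g21 \<in> K" "g22 \<in> K"
    unfolding g11_def g12_def g21_def g22_def D_def
    using entries_in[OF reached[of n]] entries_in[OF reached[of m]]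
    by (auto intro: ring_subset_field)
  note eigen = transition_eigenvector[OF reached reached m(2)[symmetric] g, folded l_def]
  \<comment> \<open>The row \<open>(- 1, z)\<close> annihilates the column \<open>(z, 1)\<close>,
    hence so does its image under the transition matrix.\<close>
  have "g21 * (z * z) + (g22 - g11) * z + (- g12) = z * (g21 * z - g11) + (g22 * z - g12)"
    by (simp add: algebra_simps)
  then have rel: "g21 * (z * z) + (g22 - g11) * z + (- g12) = 0" using eigen by simp
  moreover have "g21 \<noteq> 0 \<or> g22 - g11 \<noteq> 0 \<or> - g12 \<noteq> 0"
  proof (rule ccontr)
    assume "\<not> ?thesis"
    then have s: "g21 = 0" "g22 = g11" "g12 = 0" by auto
    then have "g11 = l" using eigen(1) by simp
    then have "(p m * q' m - p' m * q m) = l * l * D"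
      unfolding g s D_def by (simp add: algebra_simps)
    then have "cmod ((- 1) ^ m * b m) = cmod (l * l * ((- 1) ^ n * b n))"
      using det_eq[OF reached[of m]] det_eq[OF reached[of n]] by (simp only: D_def)
    then have "cmod (b m) = cmod l * cmod l * cmod (b n)"
      by (simp add: norm_mult norm_power)
    also have "\<dots> \<le> 1 * cmod l * \<beta>"
      using l1 \<beta>1 \<beta>[OF reached[of n]] by (intro mult_mono) auto
    also have "\<dots> < 1" using l \<beta>1 by (simp add: field_simps)
    finally show False using \<beta>[OF reached[of m]] by simp
  qed
  ultimately show ?thesis using quadratic_relation_imp_degree K by (meson field_diff field_uminus)
qed

lemma finite_iff_degree:
  "finite {cf_z z a b n | n. reached n} \<longleftrightarrow> (\<exists>d\<le>2. has_degree \<Delta> z d)"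
  using finite_imp_degree degree_2_finite in_field_not_infinite not_infinite_finite
  unfolding has_degree_le_2_iff by blast

end

section \<open>Periodic coefficients\<close>

context cf_run
begin

text \<open>Two tails with the same coefficients agree: the map \<open>z\<^sub>n \<mapsto> z\<^sub>n\<^sub>-\<^sub>1\<close> contracts after weighting
  distances by \<open>1 / |b\<^sub>n|\<close>.\<close>

lemma eventually_periodic_finite:
  assumes inf: "cf_infinite z a b" and per: "eventually_periodic (\<lambda>n. (a n, b n))"
  shows "finite {cf_z z a b n | n. reached n}"
proof -
  have reached: "reached n" for n using inf by (simp add: infinite_iff)
  then have e_nz: "e n \<noteq> 0" for n using reached_Suc by blast
  obtain N k where k: "k > 0" and "\<And>n. n \<ge> N \<Longrightarrow> (a (n + k), b (n + k)) = (a n, b n)"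
    using per unfolding eventually_periodic_def by blast
  then have per: "a (n + k) = a n" "b (n + k) = b n" if "n \<ge> N" for n using that by auto
  have b_nz: "b n \<noteq> 0" for n using b_in reached by blast
  have b_ge: "cmod (b n) \<ge> 1" for n using b_in reached cmod_ge_1 by blast
  \<comment> \<open>\<open>w n\<close> is the finite value of the tail and \<open>u n\<close> its
    reciprocal; \<open>u\<close> is read only at successors, where \<open>e' (Suc n) = e n\<close>
    is nonzero.\<close>
  define w where "w n = - e' n / e n" for n
  define u where "u n = - e n / e' n" for n
  have u_le: "cmod (u (Suc n)) \<le> \<epsilon>" for n
    using error_step[OF reached[of "Suc n"]] e_nz[of n]
    by (simp add: u_def errors_Suc(2) norm_divide divide_le_eq)
  have uw: "u (Suc n) * w (Suc n) = 1" for n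
    using e_nz[of n] e_nz[of "Suc n"] by (simp add: u_def w_def errors_Suc(2))
  have w_rec: "b (Suc n) * w n = a (Suc n) + b n * u (Suc n)" for n
  proof -
    have "b n * u (Suc n) = - ((a (Suc n) * e n + b (Suc n) * e' n) / e n)"
      using b_nz[of n] by (simp add: u_def errors_Suc)
    also have "\<dots> = - a (Suc n) + b (Suc n) * w n"
      using e_nz[of n] by (simp add: w_def add_divide_distrib)
    finally show ?thesis by simp
  qed
  \<comment> \<open>The weight \<open>1 / cmod (b n)\<close> absorbs the factor \<open>b n\<close>
    of \<open>w_rec\<close>, so \<open>\<epsilon>\<close> alone relates \<open>d n\<close> to
    \<open>d (Suc n)\<close>.\<close>
  define d where "d n = cmod (w (n + k) - w n) / cmod (b n)" for n
  have d_eq: "d n = cmod (u (Suc (n + k)) - u (Suc n)) / cmod (b (Suc n))" if "n \<ge> N" for n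
  proof -
    have "b (Suc n) * w (n + k) = a (Suc n) + b n * u (Suc (n + k))"
      using w_rec[of "n + k"] per[of n] per[of "Suc n"] that by simp
    then have "b (Suc n) * (w (n + k) - w n) = b n * (u (Suc (n + k)) - u (Suc n))"
      using w_rec[of n] by (simp add: algebra_simps)
    then have "cmod (b (Suc n)) * cmod (w (n + k) - w n) = cmod (b n) * cmod (u (Suc (n + k)) - u (Suc n))"
      by (metis norm_mult)
    then show ?thesis using b_nz[of n] b_nz[of "Suc n"] by (simp add: d_def frac_eq_eq mult.commute)
  qed
  have d_le: "d n \<le> 2" if "n \<ge> N" for n
  proof -
    have "cmod (u (Suc (n + k)) - u (Suc n)) \<le> cmod (u (Suc (n + k))) + cmod (u (Suc n))"
      by (rule norm_triangle_ineq4)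
    then have "cmod (u (Suc (n + k)) - u (Suc n)) \<le> 2" using u_le[of n] u_le[of "n + k"] eps by linarith
    then show ?thesis unfolding d_eq[OF that] using b_ge[of "Suc n"] by (simp add: divide_le_eq)
  qed
  have d_step: "d n \<le> \<epsilon> * d (Suc n)" if "n \<ge> N" for n
  proof -
    define x where "x = u (Suc (n + k))"
    define y where "y = u (Suc n)"
    \<comment> \<open>Inserting \<open>u * w = 1\<close> turns a difference of reciprocals into
      \<open>x * y\<close> times a difference of tails.\<close>
    have "x - y = x * (y * w (Suc n)) - y * (x * w (Suc (n + k)))"
      using uw[of n] uw[of "n + k"] by (simp add: x_def y_def)
    then have "x - y = - (x * y * (w (Suc n + k) - w (Suc n)))" by (simp add: algebra_simps)
    then have "cmod (x - y) = cmod x * cmod y * cmod (w (Suc n + k) - w (Suc n))"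
      by (simp add: norm_mult)
    also have "\<dots> \<le> \<epsilon> * 1 * cmod (w (Suc n + k) - w (Suc n))"
      using u_le[of n] u_le[of "n + k"] eps by (intro mult_right_mono mult_mono) (auto simp: x_def y_def)
    finally have "cmod (x - y) / cmod (b (Suc n)) \<le> \<epsilon> * cmod (w (Suc n + k) - w (Suc n)) / cmod (b (Suc n))"
      by (intro divide_right_mono) auto
    then show ?thesis using d_eq[OF that] unfolding x_def y_def by (simp add: d_def[of "Suc n"])
  qed
  have "w (n + k) = w n" if n: "n \<ge> N" for n
  proof -
    have "d n \<le> \<epsilon> ^ j * d (n + j)" for j
    proof (induction j)
      case (Suc j)
      have "\<epsilon> ^ j * d (n + j) \<le> \<epsilon> ^ j * (\<epsilon> * d (Suc (n + j)))"
        using d_step[of "n + j"] n eps by (intro mult_left_mono) auto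
      then show ?case using Suc by (simp add: mult_ac)
    qed simp
    moreover have "\<epsilon> ^ j * d (n + j) \<le> \<epsilon> ^ j * 2" for j
      using d_le[of "n + j"] n eps by (intro mult_left_mono) auto
    ultimately have le: "d n \<le> \<epsilon> ^ j * 2" for j using order.trans by blast
    have "d n \<le> 0"
    proof (rule ccontr)
      assume "\<not> d n \<le> 0"
      then obtain j where "\<epsilon> ^ j < d n / 2" using real_arch_pow_inv[of "d n / 2" \<epsilon>] eps by auto
      then show False using le[of j] by simp
    qed
    moreover have "d n \<ge> 0" by (simp add: d_def)
    ultimately have "d n = 0" by linarith
    then show ?thesis using b_nz[of n] by (simp add: d_def)
  qed
  then have "w n \<in> w ` {..<N + k}" for n
  proof (induction n rule: less_induct)
    case (less n)
    show ?case
    proof (cases "n < N + k")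
      case False
      then have "w n = w (n - k)" using less.prems[of "n - k"] by simp
      then show ?thesis using less.IH[of "n - k"] less.prems False k by simp
    qed auto
  qed
  moreover have "cf_z z a b n = Some (w n)" for n
    using cf_z_eq[OF reached] e_nz by (simp add: w_def)
  ultimately have "{cf_z z a b n | n. reached n} \<subseteq> Some ` w ` {..<N + k}" by auto
  then show ?thesis by (rule finite_subset) simp
qed

end

section \<open>Ideals and existence of a step\<close>

context imag_quad_order
begin

section \<open>Residues, finite index and the unit ideal\<close>

text \<open>\<open>\<rho>\<close> codes reduction modulo \<open>N\<close> by the residues of both
  coordinates; it carries meaning only on the order.\<close>

lemma finite_residues:
  fixes N :: int
  assumes "N > 0"
  obtains \<rho> :: "complex \<Rightarrow> int \<times> int" where "finite (range \<rho>)"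
    "\<And>u v. u \<in> R \<Longrightarrow> v \<in> R \<Longrightarrow> \<rho> u = \<rho> v \<Longrightarrow> \<exists>c\<in>R. u - v = of_int N * c"
proof -
  have "\<forall>u\<in>R. \<exists>t :: int \<times> int. u = of_int (fst t) + of_int (snd t) * tau"
    by (metis ringE fst_conv snd_conv)
  then obtain t :: "complex \<Rightarrow> int \<times> int"
    where t: "\<And>u. u \<in> R \<Longrightarrow> u = of_int (fst (t u)) + of_int (snd (t u)) * tau"
    using bchoice[of R "\<lambda>u t. u = of_int (fst t) + of_int (snd t) * tau"] by blast
  define \<rho> where "\<rho> u = (fst (t u) mod N, snd (t u) mod N)" for u
  show ?thesis
  proof
    have "range \<rho> \<subseteq> {0..<N} \<times> {0..<N}" using assms by (auto simp: \<rho>_def)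
    then show "finite (range \<rho>)" by (rule finite_subset) simp
  next
    fix u v assume uv: "u \<in> R" "v \<in> R" "\<rho> u = \<rho> v"
    then have "N dvd fst (t u) - fst (t v)" "N dvd snd (t u) - snd (t v)"
      by (simp_all add: \<rho>_def mod_eq_dvd_iff)
    then obtain x y where xy: "fst (t u) - fst (t v) = N * x" "snd (t u) - snd (t v) = N * y"
      by (auto elim!: dvdE)
    have "u - v = of_int (fst (t u) - fst (t v)) + of_int (snd (t u) - snd (t v)) * tau"
      using t[OF uv(1)] t[OF uv(2)] by (simp add: algebra_simps)
    also have "\<dots> = of_int N * (of_int x + of_int y * tau)"
      unfolding xy by (simp add: algebra_simps)
    finally show "\<exists>c\<in>R. u - v = of_int N * c" using ringI by blast
  qed
qed

lemma ring_divides_int: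
  assumes "u \<in> R" "u \<noteq> 0"
  obtains k :: int and c where "k > 0" "c \<in> R" "of_int k = u * c"
proof -
  obtain k :: int where k: "u * cnj u = of_int k" "(cmod u)\<^sup>2 = of_int k"
    using cmod_square_int assms(1) by blast
  have "0 < (cmod u)\<^sup>2" using assms by simp
  then have "k > 0" using k by simp
  then show ?thesis using that[of k "cnj u"] k ring_cnj assms by simp
qed

text \<open>Supplies one integer modulus divisible by every possible \<open>b n\<close>, and so by
  every determinant.\<close>

lemma common_multiple_int:
  assumes "finite S" "S \<subseteq> R - {0}"
  shows "\<exists>N::int. N > 0 \<and> (\<forall>u\<in>S. \<exists>c\<in>R. of_int N = u * c)"
  using assms
proof (induction S rule: finite_induct)
  case empty
  show ?case by (intro exI[of _ 1]) simp
next
  case (insert u S)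
  then obtain N :: int where N: "N > 0" "\<forall>u\<in>S. \<exists>c\<in>R. of_int N = u * c" by auto
  obtain k :: int and c where k: "k > 0" "c \<in> R" "of_int k = u * c"
    using ring_divides_int[of u] insert.prems by auto
  show ?case
  proof (intro exI[of _ "N * k"] conjI ballI)
    fix v assume "v \<in> insert u S"
    then consider "v = u" | d where "d \<in> R" "of_int N = v * d" using N by blast
    then show "\<exists>c\<in>R. of_int (N * k) = v * c"
    proof cases
      case 1
      then show ?thesis using k by (intro bexI[of _ "of_int N * c"]) auto
    next
      case 2
      then show ?thesis by (intro bexI[of _ "d * of_int k"]) auto
    qed
  qed (use N k in simp)
qed

text \<open>As \<open>card\<close> is 0 on infinite sets, this amounts to finite index: a nonzero
  ideal contains a positive integer \<open>k\<close>, and residues modulo \<open>k\<close> determine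
  the cosets.\<close>

lemma ideal_norm_pos:
  assumes "integral_ideal \<Delta> J"
  shows "ideal_norm \<Delta> J \<ge> 1"
proof -
  have J: "J \<subseteq> R" "0 \<in> J" "J \<noteq> {0}" "\<And>x y. x \<in> J \<Longrightarrow> y \<in> J \<Longrightarrow> x + y \<in> J"
    "\<And>c x. c \<in> R \<Longrightarrow> x \<in> J \<Longrightarrow> c * x \<in> J"
    using assms by (auto simp: integral_ideal_def invertible_ideal_def frac_ideal_def)
  obtain x where x: "x \<in> J" "x \<noteq> 0" using J by blast
  then obtain k :: int and c where k: "k > 0" "c \<in> R" "of_int k = x * c"
    using ring_divides_int[of x] J by blast
  obtain \<rho> :: "complex \<Rightarrow> int \<times> int" where \<rho>: "finite (range \<rho>)"
    "\<And>u v. u \<in> R \<Longrightarrow> v \<in> R \<Longrightarrow> \<rho> u = \<rho> v \<Longrightarrow> \<exists>c\<in>R. u - v = of_int k * c"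
    using finite_residues[OF k(1)] by blast
  have sub: "u +o J \<subseteq> v +o J" if uv: "u \<in> R" "v \<in> R" "\<rho> u = \<rho> v" for u v
  proof
    fix s assume "s \<in> u +o J"
    then obtain j where j: "j \<in> J" "s = u + j" by (auto simp: elt_set_plus_def)
    obtain d where d: "d \<in> R" "u - v = of_int k * d" using \<rho>(2)[OF uv] by blast
    have "u - v = (c * d) * x" using d k(3) by simp
    then have "u - v \<in> J" using J(5)[of "c * d" x] k(2) d(1) x(1) by auto
    then have "(u - v) + j \<in> J" using J(4) j(1) by blast
    moreover have "s = v + ((u - v) + j)" using j by simp
    ultimately show "s \<in> v +o J" unfolding elt_set_plus_def by blast
  qed
  have "u +o J = inv_into R \<rho> (\<rho> u) +o J" if "u \<in> R" for u
    using sub that by (simp add: f_inv_into_f inv_into_into set_eq_subset)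
  then have "(\<lambda>u. u +o J) ` R = (\<lambda>t. inv_into R \<rho> t +o J) ` \<rho> ` R"
    unfolding image_image by (intro image_cong) auto
  moreover have "finite (\<rho> ` R)" using \<rho>(1) by (rule finite_subset[rotated]) auto
  ultimately have "finite ((\<lambda>u. u +o J) ` R)" by simp
  moreover have "(\<lambda>u. u +o J) ` R \<noteq> {}" using zero_one_in_ring by blast
  ultimately show ?thesis unfolding ideal_norm_def by (simp add: Suc_le_eq card_gt_0_iff)
qed

text \<open>Its norm 1 is the least possible by \<open>ideal_norm_pos\<close>. This is the column
  ideal of the initial matrix.\<close>

lemma reduced_unit_ideal: "reduced_ideal \<Delta> R"
proof -
  have inv: "ideal_inv \<Delta> R = R"
    unfolding ideal_inv_def using ring_subset_field zero_one_in_ring(2) by (auto, metis mult.right_neutral)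
  have "ideal_mult R R = R"
  proof
    show "ideal_mult R R \<subseteq> R"
    proof
      fix s assume "s \<in> ideal_mult R R"
      then obtain n :: nat and x y where s: "s = (\<Sum>i<n. x i * y i)" "\<forall>i<n. x i \<in> R \<and> y i \<in> R"
        unfolding ideal_mult_def by blast
      have "(\<Sum>i<m. x i * y i) \<in> R" if "m \<le> n" for m
        using that by (induction m) (use s(2) in \<open>auto intro!: ring_add ring_mult\<close>)
      then show "s \<in> R" using s(1) by blast
    qed
    show "R \<subseteq> ideal_mult R R"
    proof
      fix s assume "s \<in> R"
      then show "s \<in> ideal_mult R R" unfolding ideal_mult_def
        by (intro CollectI exI[of _ "1 :: nat"] exI[of _ "\<lambda>_. s"] exI[of _ "\<lambda>_. 1"]) simp
    qed
  qed
  moreover have "frac_ideal \<Delta> R"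
  proof -
    have "R \<noteq> {0}" using zero_one_in_ring(2) by (metis singletonD zero_neq_one)
    moreover have "1 \<in> R - {0}" "1 *o R \<subseteq> R" by (auto simp: elt_set_times_def)
    ultimately show ?thesis unfolding frac_ideal_def
      by (intro conjI ballI subsetI bexI[of _ 1]) (auto intro: ring_subset_field)
  qed
  ultimately have "integral_ideal \<Delta> R"
    by (simp add: integral_ideal_def invertible_ideal_def inv)
  moreover have "u +o R = R" if "u \<in> R" for u
  proof -
    have "s \<in> u +o R" if "s \<in> R" for s
      unfolding elt_set_plus_def using ring_diff[OF that \<open>u \<in> R\<close>] by (intro CollectI bexI[of _ "s - u"]) auto
    then show ?thesis using that by (auto simp: elt_set_plus_def)
  qed
  then have "(\<lambda>u. u +o R) ` R = {R}" using zero_one_in_ring(1) by (auto simp: image_iff intro!: exI[of _ 0])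
  then have "ideal_norm \<Delta> R = 1" by (simp add: ideal_norm_def)
  ultimately show ?thesis using ideal_norm_pos by (simp add: reduced_ideal_def)
qed

section \<open>Ideals with two generators\<close>

lemma ideal_gen2_unit: "ideal_gen2 \<Delta> 1 0 = R"
proof -
  have "u \<in> ideal_gen2 \<Delta> 1 0" if "u \<in> R" for u
  proof -
    have "u = u * 1 + 0 * 0" by simp
    then show ?thesis unfolding ideal_gen2_def using that zero_one_in_ring(1) by blast
  qed
  then show ?thesis by (auto simp: ideal_gen2_def)
qed

text \<open>Shows that the column ideal contains \<open>b n\<close>, the determinant up to
  sign.\<close>

lemma det_mem_ideal_gen2:
  assumes "x * y' - x' * y = \<sigma> * c" "\<sigma> = 1 \<or> \<sigma> = - 1" "x' \<in> R" "y' \<in> R"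
  shows "c \<in> ideal_gen2 \<Delta> x y"
proof -
  have \<sigma>: "\<sigma> * \<sigma> = 1" "\<sigma> \<in> R" using assms(2) by auto
  have "(\<sigma> * y') * x + (- \<sigma> * x') * y = \<sigma> * (x * y' - x' * y)" by (simp add: algebra_simps)
  also have "\<dots> = (\<sigma> * \<sigma>) * c" unfolding assms(1) by (simp add: mult.assoc)
  finally have "c = (\<sigma> * y') * x + (- \<sigma> * x') * y" using \<sigma> by simp
  moreover have "\<sigma> * y' \<in> R" "- \<sigma> * x' \<in> R" using \<sigma> assms by auto
  ultimately show ?thesis unfolding ideal_gen2_def by blast
qed

lemma ideal_gen2_unimodular:
  assumes "h11 \<in> R" "h12 \<in> R" "h21 \<in> R" "h22 \<in> R" "h11 * h22 - h12 * h21 = 1"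
  shows "ideal_gen2 \<Delta> (h11 * x + h12 * y) (h21 * x + h22 * y) = ideal_gen2 \<Delta> x y"
proof
  show "ideal_gen2 \<Delta> (h11 * x + h12 * y) (h21 * x + h22 * y) \<subseteq> ideal_gen2 \<Delta> x y"
  proof
    fix s assume "s \<in> ideal_gen2 \<Delta> (h11 * x + h12 * y) (h21 * x + h22 * y)"
    then obtain u v where uv: "u \<in> R" "v \<in> R" "s = u * (h11 * x + h12 * y) + v * (h21 * x + h22 * y)"
      unfolding ideal_gen2_def by blast
    have "s = (u * h11 + v * h21) * x + (u * h12 + v * h22) * y"
      unfolding uv by (simp add: algebra_simps)
    moreover have "u * h11 + v * h21 \<in> R" "u * h12 + v * h22 \<in> R" using uv assms by auto
    ultimately show "s \<in> ideal_gen2 \<Delta> x y" unfolding ideal_gen2_def by blast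
  qed
  show "ideal_gen2 \<Delta> x y \<subseteq> ideal_gen2 \<Delta> (h11 * x + h12 * y) (h21 * x + h22 * y)"
  proof
    fix s assume "s \<in> ideal_gen2 \<Delta> x y"
    then obtain u v where uv: "u \<in> R" "v \<in> R" "s = u * x + v * y"
      unfolding ideal_gen2_def by blast
    have "(u * h22 - v * h21) * (h11 * x + h12 * y) + (v * h11 - u * h12) * (h21 * x + h22 * y)
        = (h11 * h22 - h12 * h21) * (u * x + v * y)"
      by (simp add: algebra_simps)
    then have "s = (u * h22 - v * h21) * (h11 * x + h12 * y) + (v * h11 - u * h12) * (h21 * x + h22 * y)"
      using uv(3) assms(5) by simp
    moreover have "u * h22 - v * h21 \<in> R" "v * h11 - u * h12 \<in> R" using uv assms by auto
    ultimately show "s \<in> ideal_gen2 \<Delta> (h11 * x + h12 * y) (h21 * x + h22 * y)"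
      unfolding ideal_gen2_def by blast
  qed
qed

lemma ideal_inv_closed:
  "x \<in> ideal_inv \<Delta> I \<Longrightarrow> y \<in> ideal_inv \<Delta> I \<Longrightarrow> x + y \<in> ideal_inv \<Delta> I"
  "c \<in> R \<Longrightarrow> x \<in> ideal_inv \<Delta> I \<Longrightarrow> c * x \<in> ideal_inv \<Delta> I"
  unfolding ideal_inv_def using ring_subset_field
  by (auto simp: distrib_right mult.assoc)

text \<open>Invertibility writes \<open>1\<close> as a sum of products; expanding each left factor
  in \<open>x\<close> and \<open>y\<close> and collecting terms gives \<open>s\<close> and
  \<open>t\<close>.\<close>

lemma invertible_gen2_bezout:
  assumes "invertible_ideal \<Delta> (ideal_gen2 \<Delta> x y)"
  obtains s t where "s \<in> ideal_inv \<Delta> (ideal_gen2 \<Delta> x y)" "t \<in> ideal_inv \<Delta> (ideal_gen2 \<Delta> x y)"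
    "x * s + y * t = 1"
proof -
  let ?I = "ideal_gen2 \<Delta> x y"
  define S where "S = {x * s + y * t | s t. s \<in> ideal_inv \<Delta> ?I \<and> t \<in> ideal_inv \<Delta> ?I}"
  have "1 \<in> ideal_mult ?I (ideal_inv \<Delta> ?I)"
    using assms by (simp add: invertible_ideal_def)
  then obtain n :: nat and f g where s: "1 = (\<Sum>i<n. f i * g i)" "\<forall>i<n. f i \<in> ?I \<and> g i \<in> ideal_inv \<Delta> ?I"
    unfolding ideal_mult_def by blast
  have zero: "0 \<in> ideal_inv \<Delta> ?I" by (simp add: ideal_inv_def)
  have "(\<Sum>i<m. f i * g i) \<in> S" if "m \<le> n" for m
    using that
  proof (induction m)
    case 0
    have "(\<Sum>i<0. f i * g i) = x * 0 + y * 0" by simp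
    then show ?case unfolding S_def using zero by blast
  next
    case (Suc m)
    then obtain s' t' where IH: "(\<Sum>i<m. f i * g i) = x * s' + y * t'"
      "s' \<in> ideal_inv \<Delta> ?I" "t' \<in> ideal_inv \<Delta> ?I" unfolding S_def by auto
    have "f m \<in> ?I" and g: "g m \<in> ideal_inv \<Delta> ?I" using s(2) Suc.prems by auto
    then obtain u v where uv: "u \<in> R" "v \<in> R" "f m = u * x + v * y" unfolding ideal_gen2_def by blast
    have "(\<Sum>i<Suc m. f i * g i) = x * (s' + u * g m) + y * (t' + v * g m)"
      by (simp add: IH(1) uv(3) algebra_simps)
    moreover have "s' + u * g m \<in> ideal_inv \<Delta> ?I" "t' + v * g m \<in> ideal_inv \<Delta> ?I"
      using IH g uv ideal_inv_closed by auto
    ultimately show ?case unfolding S_def by blast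
  qed
  then have "1 \<in> S" using s(1) by (metis order.refl)
  then show ?thesis using that unfolding S_def by auto
qed

text \<open>With \<open>x s + y t = 1\<close>, the vectors \<open>(x, y)\<close> and \<open>(- t, s)\<close> identify \<open>\<bb>\<^sup>-\<^sup>1 \<oplus> \<bb>\<close> with the square
  of the order.\<close>

lemma ideal_gen2_adapted_basis:
  fixes x y s t \<alpha> \<beta> :: complex
  defines "I \<equiv> ideal_gen2 \<Delta> x y"
  assumes st: "s \<in> ideal_inv \<Delta> I" "t \<in> ideal_inv \<Delta> I" "x * s + y * t = 1"
  shows "ideal_gen2 \<Delta> (\<alpha> * x - \<beta> * t) (\<alpha> * y + \<beta> * s) = \<alpha> *o I + \<beta> *o ideal_inv \<Delta> I"
proof
  show "ideal_gen2 \<Delta> (\<alpha> * x - \<beta> * t) (\<alpha> * y + \<beta> * s) \<subseteq> \<alpha> *o I + \<beta> *o ideal_inv \<Delta> I"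
  proof
    fix r assume "r \<in> ideal_gen2 \<Delta> (\<alpha> * x - \<beta> * t) (\<alpha> * y + \<beta> * s)"
    then obtain u v where uv: "u \<in> R" "v \<in> R" "r = u * (\<alpha> * x - \<beta> * t) + v * (\<alpha> * y + \<beta> * s)"
      unfolding ideal_gen2_def by blast
    have "r = \<alpha> * (u * x + v * y) + \<beta> * ((- u) * t + v * s)"
      unfolding uv by (simp add: algebra_simps)
    moreover have "u * x + v * y \<in> I" unfolding I_def ideal_gen2_def using uv by blast
    moreover have "(- u) * t + v * s \<in> ideal_inv \<Delta> I"
      using uv st by (intro ideal_inv_closed) auto
    ultimately show "r \<in> \<alpha> *o I + \<beta> *o ideal_inv \<Delta> I"
      unfolding elt_set_times_def set_plus_def by blast
  qed
  show "\<alpha> *o I + \<beta> *o ideal_inv \<Delta> I \<subseteq> ideal_gen2 \<Delta> (\<alpha> * x - \<beta> * t) (\<alpha> * y + \<beta> * s)"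
  proof
    fix r assume "r \<in> \<alpha> *o I + \<beta> *o ideal_inv \<Delta> I"
    then obtain i j where ij: "i \<in> I" "j \<in> ideal_inv \<Delta> I" "r = \<alpha> * i + \<beta> * j"
      unfolding elt_set_times_def set_plus_def by blast
    \<comment> \<open>Cramer's rule for \<open>u * x + v * y = i\<close> and
      \<open>v * s - u * t = j\<close>, with determinant \<open>x * s + y * t = 1\<close>.\<close>
    define u where "u = i * s - j * y"
    define v where "v = j * x + i * t"
    have xy: "x \<in> I" "y \<in> I" unfolding I_def by (rule ideal_gen2_mem)+
    have "s * i \<in> R" "t * i \<in> R" "j * x \<in> R" "j * y \<in> R"
      using ij st xy by (simp_all add: ideal_inv_def)
    then have uv: "u \<in> R" "v \<in> R"
      unfolding u_def v_def by (simp_all add: mult.commute[of i] ring_diff ring_add)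
    have "u * (\<alpha> * x - \<beta> * t) + v * (\<alpha> * y + \<beta> * s) = (x * s + y * t) * (\<alpha> * i + \<beta> * j)"
      unfolding u_def v_def by (simp add: algebra_simps)
    then have "r = u * (\<alpha> * x - \<beta> * t) + v * (\<alpha> * y + \<beta> * s)" using st ij by simp
    then show "r \<in> ideal_gen2 \<Delta> (\<alpha> * x - \<beta> * t) (\<alpha> * y + \<beta> * s)"
      unfolding ideal_gen2_def using uv by blast
  qed
qed

text \<open>In the basis \<open>(x, y)\<close>, \<open>(- t, s)\<close> the second column has
  coordinates \<open>\<alpha>0\<close> and \<open>\<sigma> * c\<close>, so the new first column has
  \<open>\<alpha> = (a + b * \<alpha>0) / c\<close> and \<open>\<sigma> * b\<close>. Its ideal is
  thus the one that the covering controls.\<close>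

lemma admissible_step:
  fixes x y x' y' c \<sigma> w :: complex
  assumes adm: "admissible \<Delta> B \<epsilon>" and in_R: "x \<in> R" "y \<in> R" "x' \<in> R" "y' \<in> R"
    and det: "x * y' - x' * y = \<sigma> * c" "\<sigma> = 1 \<or> \<sigma> = - 1" "c \<noteq> 0"
    and red: "reduced_ideal \<Delta> (ideal_gen2 \<Delta> x y)" "ideal_gen2 \<Delta> x y \<inter> B \<noteq> {}"
  obtains a b where "b \<in> B" "a \<in> R" "cmod (a - b * w) \<le> \<epsilon> * cmod c"
    "reduced_ideal \<Delta> (ideal_gen2 \<Delta> ((a * x + b * x') / c) ((a * y + b * y') / c))"
proof -
  let ?I = "ideal_gen2 \<Delta> x y"
  have xy: "x \<in> ?I" "y \<in> ?I" by (rule ideal_gen2_mem)+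
  have "invertible_ideal \<Delta> ?I" using red(1) by (simp add: reduced_ideal_def integral_ideal_def)
  then obtain s t where st: "s \<in> ideal_inv \<Delta> ?I" "t \<in> ideal_inv \<Delta> ?I" "x * s + y * t = 1"
    by (rule invertible_gen2_bezout)
  define \<alpha>0 where "\<alpha>0 = x' * s + y' * t"
  have \<alpha>0: "\<alpha>0 \<in> ideal_inv \<Delta> ?I"
    unfolding \<alpha>0_def using st in_R by (intro ideal_inv_closed)
  have cov: "(\<Union>(a, b) \<in> {(a, b). a \<in> ideal_inv \<Delta> ?I \<and> b \<in> ?I \<inter> B \<and>
                        reduced_ideal \<Delta> (a *o ?I + b *o ideal_inv \<Delta> ?I)}.
           cball (a / b) (\<epsilon> / cmod b)) = UNIV"
    using adm red unfolding admissible_def by blast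
  \<comment> \<open>This point has distance \<open>cmod (a - b * w) / cmod (b * c)\<close> from
    \<open>\<alpha> / b\<close>, for the \<open>a\<close> defined below.\<close>
  have "(\<alpha>0 + w) / c \<in> (\<Union>(a, b) \<in> {(a, b). a \<in> ideal_inv \<Delta> ?I \<and> b \<in> ?I \<inter> B \<and>
                        reduced_ideal \<Delta> (a *o ?I + b *o ideal_inv \<Delta> ?I)}.
           cball (a / b) (\<epsilon> / cmod b))"
    unfolding cov by simp
  then obtain \<alpha> b where ab: "\<alpha> \<in> ideal_inv \<Delta> ?I" "b \<in> ?I" "b \<in> B"
    "reduced_ideal \<Delta> (\<alpha> *o ?I + b *o ideal_inv \<Delta> ?I)" "dist (\<alpha> / b) ((\<alpha>0 + w) / c) \<le> \<epsilon> / cmod b"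
    by auto
  have b0: "b \<noteq> 0" using ab(3) adm by (auto simp: admissible_def)
  define a where "a = c * \<alpha> - b * \<alpha>0"
  have \<sigma>: "\<sigma> * \<sigma> = 1" "\<sigma> \<in> R" using det(2) by auto
  have c: "c \<in> ?I" using det_mem_ideal_gen2[OF det(1,2) in_R(3,4)] .
  \<comment> \<open>\<open>\<alpha>\<close> and \<open>\<alpha>0\<close> lie only in the inverse
    ideal, but \<open>c\<close> and \<open>b\<close> lie in the ideal, so \<open>a\<close> is
    integral.\<close>
  have "\<alpha> * c \<in> R" "\<alpha>0 * b \<in> R" using ab \<alpha>0 c by (simp_all add: ideal_inv_def)
  then have aR: "a \<in> R" unfolding a_def by (simp add: mult.commute ring_diff)
  have "a - b * w = b * c * (\<alpha> / b - (\<alpha>0 + w) / c)"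
    using b0 det(3) by (simp add: a_def field_simps)
  then have "cmod (a - b * w) = cmod b * cmod c * dist (\<alpha> / b) ((\<alpha>0 + w) / c)"
    by (simp add: norm_mult dist_norm)
  also have "\<dots> \<le> cmod b * cmod c * (\<epsilon> / cmod b)" by (intro mult_left_mono ab) auto
  also have "\<dots> = \<epsilon> * cmod c" using b0 by simp
  finally have close: "cmod (a - b * w) \<le> \<epsilon> * cmod c" .
  have x': "x' = \<alpha>0 * x - \<sigma> * c * t"
  proof -
    have "\<alpha>0 * x - \<sigma> * c * t = x' * (x * s + y * t)"
      unfolding det(1)[symmetric] \<alpha>0_def by (simp add: algebra_simps)
    then show ?thesis using st by simp
  qed
  have y': "y' = \<alpha>0 * y + \<sigma> * c * s"
  proof -
    have "\<alpha>0 * y + \<sigma> * c * s = y' * (x * s + y * t)"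
      unfolding det(1)[symmetric] \<alpha>0_def by (simp add: algebra_simps)
    then show ?thesis using st by simp
  qed
  have "(a * x + b * x') / c = \<alpha> * x - (\<sigma> * b) * t" "(a * y + b * y') / c = \<alpha> * y + (\<sigma> * b) * s"
    unfolding x' y' a_def using det(3) by (simp_all add: field_simps)
  then have "ideal_gen2 \<Delta> ((a * x + b * x') / c) ((a * y + b * y') / c)
      = \<alpha> *o ?I + (\<sigma> * b) *o ideal_inv \<Delta> ?I"
    using ideal_gen2_adapted_basis[OF st] by simp
  also have "(\<sigma> * b) *o ideal_inv \<Delta> ?I = b *o ideal_inv \<Delta> ?I"
  proof -
    have "(\<sigma> * b) * j = b * (\<sigma> * j)" "b * j = (\<sigma> * b) * (\<sigma> * j)" for j
      using \<sigma>(1) by (simp_all add: mult_ac)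
    moreover have "\<sigma> * j \<in> ideal_inv \<Delta> ?I" if "j \<in> ideal_inv \<Delta> ?I" for j
      using ideal_inv_closed(2)[OF \<sigma>(2) that] .
    ultimately show ?thesis unfolding elt_set_times_def by blast
  qed
  finally have "reduced_ideal \<Delta> (ideal_gen2 \<Delta> ((a * x + b * x') / c) ((a * y + b * y') / c))"
    using ab(4) by simp
  with that ab(3) aR close show ?thesis by blast
qed

end

section \<open>Existence of periodic expansions\<close>

context imag_quad_order
begin

text \<open>As \<open>z\<close> is not in \<open>K\<close>, it never equals a first-column ratio, so
  \<open>admissible_step\<close> can be iterated forever by dependent choice.\<close>

lemma expansion_exists:
  assumes adm: "admissible \<Delta> B \<epsilon>" and zK: "z \<notin> K"
  shows "\<exists>a b. cf_expansion \<Delta> B \<epsilon> z a b"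
proof -
  have B: "B \<subseteq> R - {0}" "B \<noteq> {}" using adm by (auto simp: admissible_def)
  \<comment> \<open>A state is a matrix with its last \<open>a n\<close> and \<open>b n\<close>. The
    invariant keeps the column ideal meeting \<open>B\<close>, so that the covering applies again;
    the clause for \<open>n = 0\<close> fixes the start.\<close>
  define P :: "nat \<Rightarrow> (complex^2^2) \<times> complex \<times> complex \<Rightarrow> bool" where
    "P n s = (case s of (M, x, y) \<Rightarrow> (\<forall>i j. M $ i $ j \<in> R) \<and>
       M $ 1 $ 1 * M $ 2 $ 2 - M $ 1 $ 2 * M $ 2 $ 1 = (- 1) ^ n * y \<and> y \<noteq> 0 \<and>
       reduced_ideal \<Delta> (col1_ideal \<Delta> M) \<and> col1_ideal \<Delta> M \<inter> B \<noteq> {} \<and>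
       (n = 0 \<longrightarrow> M = mat 1 \<and> y = 1))" for n s
  define Q :: "nat \<Rightarrow> (complex^2^2) \<times> complex \<times> complex \<Rightarrow> (complex^2^2) \<times> complex \<times> complex \<Rightarrow> bool"
    where "Q n s s' = (case (s, s') of ((M, x, y), (M', x', y')) \<Rightarrow>
       M' = M ** S_mat (x' / y) (y' / y) \<and> y' \<in> B \<and> x' \<in> R \<and>
       (\<exists>w. moebius (matrix_inv M) z = Some w \<and> x' \<in> cball (y' * w) (\<epsilon> * cmod y)) \<and>
       reduced_ideal \<Delta> (col1_ideal \<Delta> M'))" for n s s'
  have "\<exists>f. \<forall>n. P n (f n) \<and> Q n (f n) (f (Suc n))"
  proof (rule dependent_nat_choice)
    have "col1_ideal \<Delta> (mat 1) = R" by (simp add: col1_ideal_def mat_def ideal_gen2_unit)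
    then have "P 0 (mat 1, 0, 1)" using B reduced_unit_ideal by (auto simp: P_def mat_def)
    then show "\<exists>s. P 0 s" by blast
  next
    fix s n assume "P n s"
    obtain M x c where s: "s = (M, x, c)" by (cases s)
    have M: "\<And>i j. M $ i $ j \<in> R" "M $ 1 $ 1 * M $ 2 $ 2 - M $ 1 $ 2 * M $ 2 $ 1 = (- 1) ^ n * c"
      "c \<noteq> 0" "reduced_ideal \<Delta> (col1_ideal \<Delta> M)" "col1_ideal \<Delta> M \<inter> B \<noteq> {}"
      using \<open>P n s\<close> by (auto simp: P_def s)
    have det: "det M \<noteq> 0" unfolding det_2 M(2) using M(3) by simp
    have "M $ 2 $ 1 * z - M $ 1 $ 1 \<noteq> 0"
    proof
      assume *: "M $ 2 $ 1 * z - M $ 1 $ 1 = 0"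
      show False
      proof (cases "M $ 2 $ 1 = 0")
        case True
        then show False using * det by (simp add: det_2)
      next
        case False
        then have "z = M $ 1 $ 1 / M $ 2 $ 1" using * by (simp add: field_simps)
        then show False using zK M(1) ring_subset_field by auto
      qed
    qed
    then obtain w where w: "moebius (matrix_inv M) z = Some w"
      using moebius_matrix_inv[OF det, of z] by simp
    have sgn: "(- 1) ^ n = (1 :: complex) \<or> (- 1) ^ n = (- 1 :: complex)"
      by (cases "even n") auto
    obtain a b where ab: "b \<in> B" "a \<in> R" "cmod (a - b * w) \<le> \<epsilon> * cmod c"
      "reduced_ideal \<Delta> (ideal_gen2 \<Delta> ((a * M $ 1 $ 1 + b * M $ 1 $ 2) / c) ((a * M $ 2 $ 1 + b * M $ 2 $ 2) / c))"
      using admissible_step[OF adm M(1) M(1) M(1) M(1) M(2) sgn M(3) M(4,5)[unfolded col1_ideal_def], of w]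
      by blast
    define M' where "M' = M ** S_mat (a / c) (b / c)"
    have M': "M' $ i $ 1 = (a * M $ i $ 1 + b * M $ i $ 2) / c" "M' $ i $ 2 = M $ i $ 1" for i
      by (simp_all add: M'_def matrix_matrix_mult_def sum_2 S_mat_def add_divide_distrib mult.commute)
    have det_step: "(a * x + b * x') / c * y - x * ((a * y + b * y') / c) = - (b / c) * (x * y' - x' * y)"
      for x y x' y' by (simp add: diff_divide_distrib[symmetric] algebra_simps)
    have red: "reduced_ideal \<Delta> (col1_ideal \<Delta> M')"
      using ab(4) by (simp add: col1_ideal_def M')
    then have "col1_ideal \<Delta> M' \<subseteq> R" by (simp add: reduced_ideal_def integral_ideal_def)
    then have "M' $ 1 $ 1 \<in> R" "M' $ 2 $ 1 \<in> R"
      unfolding col1_ideal_def using ideal_gen2_mem by blast+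
    then have "\<forall>i j. M' $ i $ j \<in> R" using M(1) by (simp add: forall_2 M'(2))
    moreover have det': "M' $ 1 $ 1 * M' $ 2 $ 2 - M' $ 1 $ 2 * M' $ 2 $ 1 = (- 1) ^ Suc n * b"
      unfolding M' det_step M(2) using M(3) by simp
    \<comment> \<open>The determinant is \<open>b\<close> up to sign, so \<open>b\<close> itself
      witnesses that the new ideal meets \<open>B\<close>.\<close>
    moreover have "b \<in> col1_ideal \<Delta> M'"
      unfolding col1_ideal_def using sgn M(1) by (intro det_mem_ideal_gen2[OF det']) (auto simp: M'(2))
    ultimately have "P (Suc n) (M', a, b)" using red ab(1) B by (auto simp: P_def)
    moreover have "Q n s (M', a, b)"
      using ab red w by (simp add: Q_def s M'_def[symmetric] dist_norm norm_minus_commute)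
    ultimately show "\<exists>s'. P (Suc n) s' \<and> Q n s s'" by blast
  qed
  then obtain f where f: "\<And>n. P n (f n)" "\<And>n. Q n (f n) (f (Suc n))" by blast
  define a where "a n = fst (snd (f n))" for n
  define b where "b n = snd (snd (f n))" for n
  have Q: "fst (f (Suc n)) = fst (f n) ** S_mat (a (Suc n) / b n) (b (Suc n) / b n)"
    "b (Suc n) \<in> B" "a (Suc n) \<in> R"
    "\<exists>w. moebius (matrix_inv (fst (f n))) z = Some w \<and> a (Suc n) \<in> cball (b (Suc n) * w) (\<epsilon> * cmod (b n))"
    "reduced_ideal \<Delta> (col1_ideal \<Delta> (fst (f (Suc n))))" for n
    using f(2)[of n] unfolding Q_def a_def b_def split_beta fst_conv snd_conv by blast+
  have f0: "fst (f 0) = mat 1" "b 0 = 1" using f(1)[of 0] by (auto simp: P_def b_def split_beta)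
  have "cf_mat a b n = fst (f n)" for n
    by (induction n) (simp_all add: f0 Q(1))
  then have "cf_expansion \<Delta> B \<epsilon> z a b"
    unfolding cf_expansion_def cf_z_def using Q(2-5) f0(2) by (simp del: cf_mat.simps)
  then show ?thesis by blast
qed

text \<open>The matrix \<open>h\<close> is unimodular with left eigenvector \<open>(- 1, z)\<close> and eigenvalue \<open>l\<close>, hence fixes \<open>z\<close>.\<close>

definition point_fixer :: "complex \<Rightarrow> complex \<Rightarrow> complex \<Rightarrow> complex \<Rightarrow> complex \<Rightarrow> complex \<Rightarrow> bool" where
  "point_fixer z h11 h12 h21 h22 l \<longleftrightarrow> h11 \<in> R \<and> h12 \<in> R \<and> h21 \<in> R \<and> h22 \<in> R \<and>
     h11 * h22 - h12 * h21 = 1 \<and> l \<noteq> 0 \<and> h21 * z - h11 = - l \<and> h22 * z - h12 = l * z"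

lemma point_fixer_one: "point_fixer z 1 0 0 1 1"
  by (simp add: point_fixer_def)

text \<open>Eigenvalues multiply because both matrices share the left eigenvector
  \<open>(- 1, z)\<close>.\<close>

lemma point_fixer_mult:
  assumes h: "point_fixer z h11 h12 h21 h22 l" and g: "point_fixer z g11 g12 g21 g22 m"
  shows "point_fixer z (h11 * g11 + h12 * g21) (h11 * g12 + h12 * g22)
    (h21 * g11 + h22 * g21) (h21 * g12 + h22 * g22) (l * m)"
proof -
  have "(h11 * g11 + h12 * g21) * (h21 * g12 + h22 * g22) - (h11 * g12 + h12 * g22) * (h21 * g11 + h22 * g21)
      = (h11 * h22 - h12 * h21) * (g11 * g22 - g12 * g21)"
    by (simp add: algebra_simps)
  then have det: "(h11 * g11 + h12 * g21) * (h21 * g12 + h22 * g22)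
      - (h11 * g12 + h12 * g22) * (h21 * g11 + h22 * g21) = 1"
    using h g by (simp add: point_fixer_def)
  have eigen: "h21 * z - h11 = - l" "h22 * z - h12 = l * z" using h by (simp_all add: point_fixer_def)
  have "(h21 * g11 + h22 * g21) * z - (h11 * g11 + h12 * g21)
      = (h21 * z - h11) * g11 + (h22 * z - h12) * g21"
    by (simp add: algebra_simps)
  also have "\<dots> = l * (g21 * z - g11)"
    unfolding eigen by (simp add: algebra_simps)
  finally have 1: "(h21 * g11 + h22 * g21) * z - (h11 * g11 + h12 * g21) = - (l * m)"
    using g by (simp add: point_fixer_def)
  have "(h21 * g12 + h22 * g22) * z - (h11 * g12 + h12 * g22)
      = (h21 * z - h11) * g12 + (h22 * z - h12) * g22"
    by (simp add: algebra_simps)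
  also have "\<dots> = l * (g22 * z - g12)"
    unfolding eigen by (simp add: algebra_simps)
  finally have 2: "(h21 * g12 + h22 * g22) * z - (h11 * g12 + h12 * g22) = l * m * z"
    using g by (simp add: point_fixer_def)
  show ?thesis using h g det 1 2 unfolding point_fixer_def by auto
qed

end

context cf_run
begin

text \<open>If \<open>M\<^sub>n\<close> and \<open>M\<^sub>m\<close> have the same determinant and are congruent modulo it, then
  \<open>M\<^sub>m M\<^sub>n\<^sup>-\<^sup>1\<close> is integral and unimodular; finitely many residues make this happen by pigeonhole.\<close>

lemma repeated_state:
  assumes inf: "cf_infinite z a b" and fin: "finite {cf_z z a b n | n. reached n}"
  obtains n m g11 g12 g21 g22 l where "n < m" "b m = b n" "point_fixer z g11 g12 g21 g22 l"
    "p m = g11 * p n + g12 * q n" "p' m = g11 * p' n + g12 * q' n"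
    "q m = g21 * p n + g22 * q n" "q' m = g21 * p' n + g22 * q' n"
proof -
  have reached: "reached n" for n using inf by (simp add: infinite_iff)
  then have e_nz: "e n \<noteq> 0" for n using reached_Suc by blast
  have b_mem: "b n \<in> insert 1 B" for n
    using stepD(1)[OF reached] by (cases n) auto
  have "finite (insert 1 B)" "insert 1 B \<subseteq> R - {0}" using finite_B B_sub by auto
  then obtain N :: int where N: "N > 0" "\<And>u. u \<in> insert 1 B \<Longrightarrow> \<exists>c\<in>R. of_int N = u * c"
    using common_multiple_int by meson
  obtain \<rho> :: "complex \<Rightarrow> int \<times> int" where \<rho>: "finite (range \<rho>)"
    "\<And>u v. u \<in> R \<Longrightarrow> v \<in> R \<Longrightarrow> \<rho> u = \<rho> v \<Longrightarrow> \<exists>c\<in>R. u - v = of_int N * c"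
    using finite_residues[OF N(1)] by blast
  \<comment> \<open>Parity belongs to the key because the determinant is
    \<open>(- 1) ^ n * b n\<close>.\<close>
  define key where "key n = (cf_z z a b n, b n, even n, \<rho> (p n), \<rho> (q n), \<rho> (p' n), \<rho> (q' n))" for n
  have "finite (range (cf_z z a b))" using fin reached by (simp add: full_SetCompr_eq)
  then have "finite (range (cf_z z a b) \<times> insert 1 B \<times> (UNIV :: bool set) \<times> range \<rho> \<times> range \<rho> \<times> range \<rho> \<times> range \<rho>)"
    using finite_B \<rho>(1) by (intro finite_cartesian_product) auto
  moreover have "range key \<subseteq> range (cf_z z a b) \<times> insert 1 B \<times> UNIV \<times> range \<rho> \<times> range \<rho> \<times> range \<rho> \<times> range \<rho>"
    using b_mem by (auto simp: key_def)
  ultimately have "finite (range key)" by (rule finite_subset[rotated])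
  then have "\<not> inj key" using finite_imageD by blast
  then obtain n m where nm: "key n = key m" "n < m" unfolding inj_def by (metis linorder_neqE_nat)
  have key: "cf_z z a b n = cf_z z a b m" "b m = b n" "even n = even m"
    "\<rho> (p m) = \<rho> (p n)" "\<rho> (q m) = \<rho> (q n)" "\<rho> (p' m) = \<rho> (p' n)" "\<rho> (q' m) = \<rho> (q' n)"
    using nm(1) by (simp_all add: key_def)
  define D where "D = p n * q' n - p' n * q n"
  have D: "D = (- 1) ^ n * b n" using det_eq[OF reached] by (simp add: D_def)
  have D_nz: "D \<noteq> 0" using det_nz[OF reached] by (simp add: D_def)
  have Dm: "p m * q' m - p' m * q m = D"
    unfolding D det_eq[OF reached[of m]] key(2) using key(3) by (cases "even n") auto
  obtain c where c: "c \<in> R" "of_int N = D * c"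
  proof -
    obtain c where "c \<in> R" "of_int N = b n * c" using N(2)[OF b_mem] by blast
    moreover have "b n = D \<or> b n = - D" unfolding D by (cases "even n") auto
    ultimately show ?thesis using that[of c] that[of "- c"] ring_uminus[of c] by auto
  qed
  have cong: "\<exists>x\<in>R. u = v + D * x" if "u \<in> R" "v \<in> R" "\<rho> u = \<rho> v" for u v
  proof -
    obtain d where "d \<in> R" "u - v = of_int N * d" using \<rho>(2) \<open>u \<in> R\<close> \<open>v \<in> R\<close> \<open>\<rho> u = \<rho> v\<close> by blast
    then have "u = v + D * (c * d)" "c * d \<in> R" using c by (auto simp: algebra_simps)
    then show ?thesis by blast
  qed
  note inR = entries_in[OF reached[of n]] entries_in[OF reached[of m]]
  obtain x1 where x1: "x1 \<in> R" "p m = p n + D * x1" using cong[of "p m" "p n"] inR key by blast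
  obtain x2 where x2: "x2 \<in> R" "q m = q n + D * x2" using cong[of "q m" "q n"] inR key by blast
  obtain x3 where x3: "x3 \<in> R" "p' m = p' n + D * x3" using cong[of "p' m" "p' n"] inR key by blast
  obtain x4 where x4: "x4 \<in> R" "q' m = q' n + D * x4" using cong[of "q' m" "q' n"] inR key by blast
  \<comment> \<open>With \<open>M\<^sub>m = M\<^sub>n + D X\<close>, these are the entries of
    \<open>M\<^sub>m M\<^sub>n\<^sup>-\<^sup>1 = 1 + X adj(M\<^sub>n)\<close>, hence
    integral.\<close>
  define g11 where "g11 = 1 + x1 * q' n - x3 * q n"
  define g12 where "g12 = x3 * p n - x1 * p' n"
  define g21 where "g21 = x2 * q' n - x4 * q n"
  define g22 where "g22 = 1 + x4 * p n - x2 * p' n"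
  have g: "p m = g11 * p n + g12 * q n" "p' m = g11 * p' n + g12 * q' n"
    "q m = g21 * p n + g22 * q n" "q' m = g21 * p' n + g22 * q' n"
    unfolding x1 x2 x3 x4 g11_def g12_def g21_def g22_def D_def by (simp_all add: algebra_simps)
  have "p m * q' m - p' m * q m = (g11 * g22 - g12 * g21) * D"
    unfolding g D_def by (simp add: algebra_simps)
  then have "g11 * g22 - g12 * g21 = 1" using Dm D_nz by simp
  moreover have "g11 \<in> R" "g12 \<in> R" "g21 \<in> R" "g22 \<in> R"
    unfolding g11_def g12_def g21_def g22_def using inR x1(1) x2(1) x3(1) x4(1)
    by (auto intro!: ring_add ring_diff ring_mult)
  moreover have "e m / e n \<noteq> 0" using e_nz by simp
  ultimately have "point_fixer z g11 g12 g21 g22 (e m / e n)"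
    using transition_eigenvector[OF reached reached key(1) g] by (simp add: point_fixer_def)
  then show ?thesis using that nm(2) key(2) g by blast
qed

text \<open>The coefficients between the two repeated indices are reused forever: \<open>r i\<close> is the index of the
  original run whose state the new run copies at time \<open>i\<close>.\<close>

lemma periodic_expansion_exists:
  assumes inf: "cf_infinite z a b" and fin: "finite {cf_z z a b n | n. reached n}"
  shows "\<exists>a b. cf_expansion \<Delta> B \<epsilon> z a b \<and> cf_infinite z a b \<and> eventually_periodic (\<lambda>n. (a n, b n))"
proof -
  have reached: "reached n" for n using inf by (simp add: infinite_iff)
  then have e_nz: "e n \<noteq> 0" for n using reached_Suc by blast
  obtain n m g11 g12 g21 g22 l where nm: "n < m" "b m = b n" and fixer: "point_fixer z g11 g12 g21 g22 l"
    and g: "p m = g11 * p n + g12 * q n" "p' m = g11 * p' n + g12 * q' n"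
    "q m = g21 * p n + g22 * q n" "q' m = g21 * p' n + g22 * q' n"
    using repeated_state[OF inf fin] .
  \<comment> \<open>The index runs up from 0 and jumps back to \<open>n\<close> instead of reaching
    \<open>m\<close>.\<close>
  define r where "r = rec_nat 0 (\<lambda>_ i. if Suc i = m then n else Suc i)"
  have r: "r 0 = 0" "r (Suc i) = (if Suc (r i) = m then n else Suc (r i))" for i
    by (simp_all add: r_def)
  \<comment> \<open>Coefficients are read at \<open>Suc (r j)\<close>, not at
    \<open>r (Suc j)\<close>: a jump must use \<open>a m\<close>, which may differ from
    \<open>a n\<close>. The value \<open>A 0\<close> is arbitrary.\<close>
  define A where "A i = (case i of 0 \<Rightarrow> 0 | Suc j \<Rightarrow> a (Suc (r j)))" for i
  define G where "G i = (case i of 0 \<Rightarrow> 1 | Suc j \<Rightarrow> b (Suc (r j)))" for i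
  have A: "A (Suc i) = a (Suc (r i))" and G0: "G 0 = 1" and G: "G (Suc i) = b (Suc (r i))" for i
    by (simp_all add: A_def G_def)
  have G_eq: "G i = b (r i)" for i
    by (cases i) (simp_all add: G0 G r nm(2))
  let ?M = "cf_mat A G"
  \<comment> \<open>The new matrix at \<open>i\<close> is the old one at \<open>j\<close> up to a
    unimodular left factor fixing \<open>z\<close>.\<close>
  define rel where "rel i j \<longleftrightarrow> (\<exists>h11 h12 h21 h22 l. point_fixer z h11 h12 h21 h22 l \<and>
      ?M i $ 1 $ 1 = h11 * p j + h12 * q j \<and> ?M i $ 1 $ 2 = h11 * p' j + h12 * q' j \<and>
      ?M i $ 2 $ 1 = h21 * p j + h22 * q j \<and> ?M i $ 2 $ 2 = h21 * p' j + h22 * q' j)" for i j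
  have rel_Suc: "rel (Suc i) (Suc (r i))" if rel_i: "rel i (r i)" for i
  proof -
    obtain h11 h12 h21 h22 l where h: "point_fixer z h11 h12 h21 h22 l"
      "?M i $ 1 $ 1 = h11 * p (r i) + h12 * q (r i)" "?M i $ 1 $ 2 = h11 * p' (r i) + h12 * q' (r i)"
      "?M i $ 2 $ 1 = h21 * p (r i) + h22 * q (r i)" "?M i $ 2 $ 2 = h21 * p' (r i) + h22 * q' (r i)"
      using rel_i unfolding rel_def by blast
    have lin: "(x * (h * s + k * t) + y * (h * s' + k * t')) / c
        = h * ((x * s + y * s') / c) + k * ((x * t + y * t') / c)" for x y h k s t s' t' c :: complex
      by (simp add: add_divide_distrib algebra_simps)
    show ?thesis unfolding rel_def
      by (intro exI[of _ h11] exI[of _ h12] exI[of _ h21] exI[of _ h22] exI[of _ l])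
        (simp only: h cf_mat_Suc_nth entries_Suc A G G_eq[of i] lin simp_thms)
  qed
  have rel: "rel i (r i)" for i
  proof (induction i)
    case 0
    show ?case unfolding rel_def r(1)
      using point_fixer_one by (intro exI[of _ 1] exI[of _ 0] exI[of _ 0] exI[of _ 1] exI[of _ 1]) (simp add: mat_def)
  next
    case (Suc i)
    have 1: "rel (Suc i) (Suc (r i))" using rel_Suc Suc .
    show ?case
    proof (cases "Suc (r i) = m")
      case False
      then show ?thesis using 1 by (simp add: r)
    next
      case True
      then obtain h11 h12 h21 h22 k where h: "point_fixer z h11 h12 h21 h22 k"
        "?M (Suc i) $ 1 $ 1 = h11 * p m + h12 * q m" "?M (Suc i) $ 1 $ 2 = h11 * p' m + h12 * q' m"
        "?M (Suc i) $ 2 $ 1 = h21 * p m + h22 * q m" "?M (Suc i) $ 2 $ 2 = h21 * p' m + h22 * q' m"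
        using 1 unfolding rel_def by blast
      \<comment> \<open>At a jump the old matrix at \<open>m\<close> is the transition matrix times
        the one at \<open>n\<close>; the left factor absorbs it.\<close>
      have "rel (Suc i) n" unfolding rel_def
      proof (intro exI conjI)
        show "point_fixer z (h11 * g11 + h12 * g21) (h11 * g12 + h12 * g22)
            (h21 * g11 + h22 * g21) (h21 * g12 + h22 * g22) (k * l)"
          using point_fixer_mult[OF h(1) fixer] .
      qed (simp_all only: h(2-) g, simp_all add: algebra_simps)
      then show ?thesis using True by (simp add: r)
    qed
  qed
  \<comment> \<open>Both errors are scaled by the eigenvalue \<open>k\<close>, so their ratio is
    that of the original run and the first stays nonzero.\<close>
  have z_eq: "cf_z z A G i = cf_z z a b (r i)" and no_stop: "\<not> cf_stops z A G i" for i
  proof -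
    obtain h11 h12 h21 h22 k where h: "point_fixer z h11 h12 h21 h22 k"
      "?M i $ 1 $ 1 = h11 * p (r i) + h12 * q (r i)" "?M i $ 1 $ 2 = h11 * p' (r i) + h12 * q' (r i)"
      "?M i $ 2 $ 1 = h21 * p (r i) + h22 * q (r i)" "?M i $ 2 $ 2 = h21 * p' (r i) + h22 * q' (r i)"
      using rel unfolding rel_def by blast
    have fx: "h11 * h22 - h12 * h21 = 1" "k \<noteq> 0" "h21 * z - h11 = - k" "h22 * z - h12 = k * z"
      using h(1) by (simp_all add: point_fixer_def)
    have "det (?M i) = (h11 * h22 - h12 * h21) * (p (r i) * q' (r i) - p' (r i) * q (r i))"
      unfolding det_2 h by (simp add: algebra_simps)
    then have det: "det (?M i) \<noteq> 0" using fx det_nz[OF reached] by simp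
    have "?M i $ 2 $ 1 * z - ?M i $ 1 $ 1 = p (r i) * (h21 * z - h11) + q (r i) * (h22 * z - h12)"
      unfolding h by (simp add: algebra_simps)
    then have e1: "?M i $ 2 $ 1 * z - ?M i $ 1 $ 1 = k * e (r i)"
      unfolding fx e_def by (simp add: algebra_simps)
    have "?M i $ 2 $ 2 * z - ?M i $ 1 $ 2 = p' (r i) * (h21 * z - h11) + q' (r i) * (h22 * z - h12)"
      unfolding h by (simp add: algebra_simps)
    then have e2: "?M i $ 2 $ 2 * z - ?M i $ 1 $ 2 = k * e' (r i)"
      unfolding fx e'_def by (simp add: algebra_simps)
    have "cf_z z A G i = Some (- (k * e' (r i)) / (k * e (r i)))"
      unfolding cf_z_def moebius_matrix_inv[OF det] e1 e2 using fx(2) e_nz by simp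
    also have "\<dots> = cf_z z a b (r i)" using cf_z_eq[OF reached] fx(2) e_nz by simp
    finally show "cf_z z A G i = cf_z z a b (r i)" .
    show "\<not> cf_stops z A G i"
    proof
      assume "cf_stops z A G i"
      then have "?M i $ 2 $ 1 * z - ?M i $ 1 $ 1 = 0" by (auto simp: cf_stops_def)
      then show False using e1 fx(2) e_nz by simp
    qed
  qed
  \<comment> \<open>The comparison is made at \<open>Suc (r i)\<close>, before any jump, where the
    original column ideal is known to be reduced.\<close>
  have red: "reduced_ideal \<Delta> (col1_ideal \<Delta> (?M (Suc i)))" for i
  proof -
    obtain h11 h12 h21 h22 k where h: "point_fixer z h11 h12 h21 h22 k"
      "?M (Suc i) $ 1 $ 1 = h11 * p (Suc (r i)) + h12 * q (Suc (r i))"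
      "?M (Suc i) $ 2 $ 1 = h21 * p (Suc (r i)) + h22 * q (Suc (r i))"
      using rel_Suc[OF rel] unfolding rel_def by blast
    have "col1_ideal \<Delta> (?M (Suc i)) = ideal_gen2 \<Delta> (p (Suc (r i))) (q (Suc (r i)))"
      unfolding col1_ideal_def h(2,3) using h(1) by (intro ideal_gen2_unimodular) (auto simp: point_fixer_def)
    then show ?thesis using stepD(4)[OF reached] by simp
  qed
  have "cf_expansion \<Delta> B \<epsilon> z A G"
    unfolding cf_expansion_def
  proof (intro conjI allI impI)
    fix i
    show "G (Suc i) \<in> B" "A (Suc i) \<in> R" unfolding A G using stepD(1,2)[OF reached] by auto
    show "\<exists>w. cf_z z A G i = Some w \<and> A (Suc i) \<in> cball (G (Suc i) * w) (\<epsilon> * cmod (G i))"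
      unfolding A G G_eq[of i] z_eq using stepD(3)[OF reached[of "Suc (r i)"]]
      by (simp add: dist_norm norm_minus_commute)
    show "reduced_ideal \<Delta> (col1_ideal \<Delta> (cf_mat A G (Suc i)))" by (rule red)
  qed (rule G0)
  moreover have "cf_infinite z A G" using no_stop by (simp add: cf_infinite_def)
  moreover have "eventually_periodic (\<lambda>i. (A i, G i))"
  proof -
    have r_small: "i < m \<Longrightarrow> r i = i" for i by (induction i) (auto simp: r)
    have "r m = n" using r(2)[of "m - 1"] r_small[of "m - 1"] nm(1) by simp
    have r_per: "r (n + j + (m - n)) = r (n + j)" for j
    proof (induction j)
      case 0
      then show ?case using \<open>r m = n\<close> r_small nm(1) by simp
    next
      case (Suc j)
      then show ?case by (simp add: r)
    qed
    \<comment> \<open>The period starts at \<open>Suc n\<close>, not \<open>n\<close>, because the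
      coefficients at \<open>Suc i\<close> depend on \<open>r i\<close>.\<close>
    have "(A (i + (m - n)), G (i + (m - n))) = (A i, G i)" if "i \<ge> Suc n" for i
    proof -
      obtain j where "i = Suc (n + j)" using le_Suc_ex[OF \<open>i \<ge> Suc n\<close>] by auto
      then show ?thesis using r_per[of j] by (simp add: A G)
    qed
    then show ?thesis unfolding eventually_periodic_def
      using nm(1) by (intro exI[of _ "Suc n"] exI[of _ "m - n"]) auto
  qed
  ultimately show ?thesis by blast
qed

end

theorem theorem4p13:
  fixes \<Delta> :: int and B :: "complex set" and \<epsilon> :: real and z :: complex
  assumes "\<Delta> < 0" and "\<Delta> mod 4 \<in> {0, 1}" and "admissible \<Delta> B \<epsilon>"
  shows "(\<forall>a b. cf_expansion \<Delta> B \<epsilon> z a b \<longrightarrow>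
            (finite {cf_z z a b n | n. cf_reaches z a b n} \<longleftrightarrow> (\<exists>d\<le>2. has_degree \<Delta> z d)))
       \<and> ((\<exists>a b. cf_expansion \<Delta> B \<epsilon> z a b \<and> cf_infinite z a b \<and>
                 eventually_periodic (\<lambda>n. (a n, b n)))
            \<longleftrightarrow> has_degree \<Delta> z 2)"
proof -
  interpret imag_quad_order \<Delta> by standard (rule assms)+
  have run: "cf_run \<Delta> B \<epsilon> z a b" if "cf_expansion \<Delta> B \<epsilon> z a b" for a b
    using that assms(3) by unfold_locales (auto simp: admissible_def)
  have "has_degree \<Delta> z 2"
    if "cf_expansion \<Delta> B \<epsilon> z a b" "cf_infinite z a b" "eventually_periodic (\<lambda>n. (a n, b n))" for a b
  proof -
    interpret cf_run \<Delta> B \<epsilon> z a b by (rule run[OF that(1)])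
    \<comment> \<open>Periodicity gives finitely many tails, so degree at most 2; an infinite run
      excludes \<open>z\<close> from \<open>K\<close>.\<close>
    show ?thesis
      using finite_imp_degree eventually_periodic_finite in_field_not_infinite that by blast
  qed
  moreover have "\<exists>a b. cf_expansion \<Delta> B \<epsilon> z a b \<and> cf_infinite z a b \<and>
      eventually_periodic (\<lambda>n. (a n, b n))" if deg: "has_degree \<Delta> z 2"
  proof -
    have zK: "z \<notin> K" using has_degree_2D(1)[OF deg] .
    \<comment> \<open>Any run serves here: it is infinite since \<open>z\<close> is not in
      \<open>K\<close>, and its finitely many tails allow a periodic one to be built.\<close>
    obtain a b where exp: "cf_expansion \<Delta> B \<epsilon> z a b" using expansion_exists[OF assms(3) zK] by blast
    interpret cf_run \<Delta> B \<epsilon> z a b by (rule run[OF exp])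
    have "cf_infinite z a b" using not_infinite_in_field zK by blast
    then show ?thesis using periodic_expansion_exists degree_2_finite[OF deg] by blast
  qed
  ultimately show ?thesis using cf_run.finite_iff_degree[OF run] by blast
qed

end
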